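(* Let $G$ be an amenable countable discrete group and $1<p<\infty$. Let $Y_p$ be the closed unit ball of $A_p(G)^*$, $X_p=\mathrm{span}\{\delta_x:x\in G\}$ with $\delta_x(f)=f(x)$, and $Z_p=X_p\cap Y_p$. Then the following are equivalent: (i) $A_p(G)$ is Arens regular. (ii) For all sequences $(f_n)$, $(g_m)$ in the closed unit ball of $A_p(G)$ and every sequence $(\phi_k)$ in $Z_p$, $\lim_n\lim_m\lim_k\phi_k(f_ng_m)=\lim_m\lim_n\lim_k\phi_k(f_ng_m)$ whenever both iterated limits exist. (iii) For all sequences $(f_n)$, $(g_m)$ in the closed unit ball of $A_p(G)$ and every sequence $(\phi_k)$ in $Z_p$, $\overline{\{\phi_k(f_ng_m): k>n>m\}}\cap\overline{\{\phi_k(f_ng_m): k>m>n\}}\neq\emptyset$ (closures in $\mathbb{C}$).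
   Context: For a discrete group $G$ and $1<p<\infty$, $\frac1p+\frac1q=1$, $A_p(G)$ is the space of functions $u=\sum_{i=1}^\infty g_i*f_i^{\vee}$ with $f_i\in \ell_p(G)$, $g_i\in \ell_q(G)$, $\sum_i\|f_i\|_p\|g_i\|_q<\infty$, where $f^{\vee}(x)=f(x^{-1})$; with pointwise multiplication and norm $\|u\|_{A_p(G)}=\inf\{\sum_i\|f_i\|_p\|g_i\|_q\}$ it is a commutative Banach algebra (the Herz algebra); its dual is identified with $PM_p(G)$, the weak-operator closure of $\ell_1(G)$ acting by convolution on $\ell_p(G)$. A Banach algebra $A$ is Arens regular if the two Arens products on $A^{**}$ coincide; equivalently, for all sequences $(a_n),(b_m)$ in the closed unit ball of $A$ and all $T\in A^*$, $\lim_n\lim_m T(a_nb_m)=\lim_m\lim_n T(a_nb_m)$ whenever both exist. *)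

theory Defs
  imports "HOL-Analysis.Analysis" "HOL-Library.Countable"
begin

text \<open>Discrete group G: a type of class group_add (written additively,
  not necessarily commutative): x y is x + y, x^{-1} is - x, identity 0.\<close>

text \<open>Amenability: existence of a left-invariant mean on l_infinity(G).\<close>
definition amenable :: "'g::group_add itself \<Rightarrow> bool" where
  "amenable _ \<longleftrightarrow> (\<exists>m :: ('g \<Rightarrow> real) \<Rightarrow> real.
     (\<forall>f g. bounded (range f) \<longrightarrow> bounded (range g) \<longrightarrow> m (\<lambda>x. f x + g x) = m f + m g) \<and>
     (\<forall>c f. bounded (range f) \<longrightarrow> m (\<lambda>x. c * f x) = c * m f) \<and>
     (\<forall>f. bounded (range f) \<longrightarrow> (\<forall>x. 0 \<le> f x) \<longrightarrow> 0 \<le> m f) \<and>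
     m (\<lambda>_. 1) = 1 \<and>
     (\<forall>f y. bounded (range f) \<longrightarrow> m (\<lambda>x. f (y + x)) = m f))"

definition conj_exp :: "real \<Rightarrow> real" where
  "conj_exp p = p / (p - 1)"

definition lp :: "real \<Rightarrow> ('g \<Rightarrow> complex) \<Rightarrow> bool" where
  "lp p f \<longleftrightarrow> (\<lambda>x. norm (f x) powr p) summable_on UNIV"

definition lpnorm :: "real \<Rightarrow> ('g \<Rightarrow> complex) \<Rightarrow> real" where
  "lpnorm p f = (\<Sum>\<^sub>\<infinity>x. norm (f x) powr p) powr (1 / p)"

text \<open>f check: f^v(x) = f(x^{-1})\<close>
definition fcheck :: "('g::group_add \<Rightarrow> complex) \<Rightarrow> 'g \<Rightarrow> complex" where
  "fcheck f = (\<lambda>x. f (- x))"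

text \<open>Convolution on a discrete group: (g * h)(x) = sum_y g(y) h(y^{-1} x).\<close>
definition conv :: "('g::group_add \<Rightarrow> complex) \<Rightarrow> ('g \<Rightarrow> complex) \<Rightarrow> 'g \<Rightarrow> complex" where
  "conv g h = (\<lambda>x. \<Sum>\<^sub>\<infinity>y. g y * h (- y + x))"

definition Ap_rep :: "real \<Rightarrow> ('g::group_add \<Rightarrow> complex) \<Rightarrow> (nat \<Rightarrow> 'g \<Rightarrow> complex)
                      \<Rightarrow> (nat \<Rightarrow> 'g \<Rightarrow> complex) \<Rightarrow> bool" where
  "Ap_rep p u f g \<longleftrightarrow>
     (\<forall>i. lp p (f i) \<and> lp (conj_exp p) (g i)) \<and>
     summable (\<lambda>i. lpnorm p (f i) * lpnorm (conj_exp p) (g i)) \<and>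
     (\<forall>x. u x = (\<Sum>i. conv (g i) (fcheck (f i)) x))"

text \<open>The Herz algebra A_p(G) and its norm.\<close>
definition Ap :: "real \<Rightarrow> ('g::group_add \<Rightarrow> complex) set" where
  "Ap p = {u. \<exists>f g. Ap_rep p u f g}"

definition Apnorm :: "real \<Rightarrow> ('g::group_add \<Rightarrow> complex) \<Rightarrow> real" where
  "Apnorm p u = Inf {\<Sum>i. lpnorm p (f i) * lpnorm (conj_exp p) (g i) | f g. Ap_rep p u f g}"

definition Ap_ball :: "real \<Rightarrow> ('g::group_add \<Rightarrow> complex) set" where
  "Ap_ball p = {u \<in> Ap p. Apnorm p u \<le> 1}"

text \<open>Dual space A_p(G)^*: bounded linear functionals on A_p(G)
  (normalised to vanish off A_p(G), so that they are determined by their action on A_p(G)).\<close>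
definition Ap_dual :: "real \<Rightarrow> (('g::group_add \<Rightarrow> complex) \<Rightarrow> complex) set" where
  "Ap_dual p = {T. (\<forall>u\<in>Ap p. \<forall>v\<in>Ap p. T (\<lambda>x. u x + v x) = T u + T v) \<and>
                   (\<forall>c. \<forall>u\<in>Ap p. T (\<lambda>x. c * u x) = c * T u) \<and>
                   (\<exists>C. \<forall>u\<in>Ap p. norm (T u) \<le> C * Apnorm p u) \<and>
                   (\<forall>u. u \<notin> Ap p \<longrightarrow> T u = 0)}"

definition dual_norm :: "real \<Rightarrow> (('g::group_add \<Rightarrow> complex) \<Rightarrow> complex) \<Rightarrow> real" where
  "dual_norm p T = Sup {norm (T u) | u. u \<in> Ap_ball p}"

text \<open>Bidual A_p(G)^{**}.\<close>
definition Ap_bidual :: "real \<Rightarrow> ((('g::group_add \<Rightarrow> complex) \<Rightarrow> complex) \<Rightarrow> complex) set" where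
  "Ap_bidual p = {F. (\<forall>S\<in>Ap_dual p. \<forall>T\<in>Ap_dual p. F (\<lambda>u. S u + T u) = F S + F T) \<and>
                     (\<forall>c. \<forall>T\<in>Ap_dual p. F (\<lambda>u. c * T u) = c * F T) \<and>
                     (\<exists>C. \<forall>T\<in>Ap_dual p. norm (F T) \<le> C * dual_norm p T) \<and>
                     (\<forall>T. T \<notin> Ap_dual p \<longrightarrow> F T = 0)}"

text \<open>Module actions and the two Arens products.
  <T.a, b> = T(ab),  <a.T, b> = T(ba),  <F.T, a> = F(T.a),  <T.F, a> = F(a.T),
  <F box G, T> = F(G.T),  <F diamond G, T> = G(T.F).\<close>
definition dual_act_r :: "real \<Rightarrow> (('g::group_add \<Rightarrow> complex) \<Rightarrow> complex) \<Rightarrow> ('g \<Rightarrow> complex)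
                          \<Rightarrow> ('g \<Rightarrow> complex) \<Rightarrow> complex" where
  "dual_act_r p T a = (\<lambda>b. if b \<in> Ap p then T (\<lambda>x. a x * b x) else 0)"

definition dual_act_l :: "real \<Rightarrow> ('g::group_add \<Rightarrow> complex) \<Rightarrow> (('g \<Rightarrow> complex) \<Rightarrow> complex)
                          \<Rightarrow> ('g \<Rightarrow> complex) \<Rightarrow> complex" where
  "dual_act_l p a T = (\<lambda>b. if b \<in> Ap p then T (\<lambda>x. b x * a x) else 0)"

definition bidual_act_l :: "real \<Rightarrow> ((('g::group_add \<Rightarrow> complex) \<Rightarrow> complex) \<Rightarrow> complex)
                            \<Rightarrow> (('g \<Rightarrow> complex) \<Rightarrow> complex) \<Rightarrow> ('g \<Rightarrow> complex) \<Rightarrow> complex" where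
  "bidual_act_l p F T = (\<lambda>a. if a \<in> Ap p then F (dual_act_r p T a) else 0)"

definition bidual_act_r :: "real \<Rightarrow> (('g::group_add \<Rightarrow> complex) \<Rightarrow> complex)
                            \<Rightarrow> ((('g \<Rightarrow> complex) \<Rightarrow> complex) \<Rightarrow> complex) \<Rightarrow> ('g \<Rightarrow> complex) \<Rightarrow> complex" where
  "bidual_act_r p T F = (\<lambda>a. if a \<in> Ap p then F (dual_act_l p a T) else 0)"

definition arens1 :: "real \<Rightarrow> ((('g::group_add \<Rightarrow> complex) \<Rightarrow> complex) \<Rightarrow> complex)
                      \<Rightarrow> ((('g \<Rightarrow> complex) \<Rightarrow> complex) \<Rightarrow> complex) \<Rightarrow> (('g \<Rightarrow> complex) \<Rightarrow> complex) \<Rightarrow> complex" where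
  "arens1 p F G = (\<lambda>T. if T \<in> Ap_dual p then F (bidual_act_l p G T) else 0)"

definition arens2 :: "real \<Rightarrow> ((('g::group_add \<Rightarrow> complex) \<Rightarrow> complex) \<Rightarrow> complex)
                      \<Rightarrow> ((('g \<Rightarrow> complex) \<Rightarrow> complex) \<Rightarrow> complex) \<Rightarrow> (('g \<Rightarrow> complex) \<Rightarrow> complex) \<Rightarrow> complex" where
  "arens2 p F G = (\<lambda>T. if T \<in> Ap_dual p then G (bidual_act_r p T F) else 0)"

definition Ap_arens_regular :: "'g::group_add itself \<Rightarrow> real \<Rightarrow> bool" where
  "Ap_arens_regular _ p \<longleftrightarrow>
     (\<forall>F \<in> Ap_bidual p. \<forall>G \<in> (Ap_bidual p :: ((('g \<Rightarrow> complex) \<Rightarrow> complex) \<Rightarrow> complex) set).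
        arens1 p F G = arens2 p F G)"

text \<open>Y_p, X_p, Z_p.\<close>
definition Yp :: "real \<Rightarrow> (('g::group_add \<Rightarrow> complex) \<Rightarrow> complex) set" where
  "Yp p = {T \<in> Ap_dual p. dual_norm p T \<le> 1}"

definition Xp :: "real \<Rightarrow> (('g::group_add \<Rightarrow> complex) \<Rightarrow> complex) set" where
  "Xp p = {T \<in> Ap_dual p. \<exists>c :: 'g \<Rightarrow> complex. finite {x. c x \<noteq> 0} \<and>
              (\<forall>u \<in> Ap p. T u = (\<Sum>x\<in>{x. c x \<noteq> 0}. c x * u x))}"

definition Zp :: "real \<Rightarrow> (('g::group_add \<Rightarrow> complex) \<Rightarrow> complex) set" where
  "Zp p = Xp p \<inter> Yp p"

text \<open>lim_n lim_m lim_k a = lim_m lim_n lim_k a whenever both iterated limits exist.\<close>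
definition iterated_limits_agree :: "(nat \<Rightarrow> nat \<Rightarrow> nat \<Rightarrow> complex) \<Rightarrow> bool" where
  "iterated_limits_agree a \<longleftrightarrow>
     (\<forall>b c d c' d'.
        (\<forall>n m. (\<lambda>k. a n m k) \<longlonglongrightarrow> b n m) \<and>
        (\<forall>n. (\<lambda>m. b n m) \<longlonglongrightarrow> c n) \<and> c \<longlonglongrightarrow> d \<and>
        (\<forall>m. (\<lambda>n. b n m) \<longlonglongrightarrow> c' m) \<and> c' \<longlonglongrightarrow> d'
        \<longrightarrow> d = d')"

end

theory Submission
  imports Defs
begin

text \<open>If \<open>A\<^sub>p(G)\<close> is Arens regular, take \<open>T\<close> to be an ultrafilter limit of \<open>(\<phi>\<^sub>k)\<close> and apply the two Arens
  products to the elements of the bidual defined by ultrafilter limits along \<open>(f\<^sub>n)\<close> and \<open>(g\<^sub>m)\<close>: both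
  iterated ultrafilter limits of \<open>T(f\<^sub>n g\<^sub>m)\<close> coincide, which yields (ii) and a common point of the two
  closures in (iii). Conversely, Helly's lemma turns a pair of bidual elements with different Arens
  products into sequences in \<open>A\<^sub>p(G)\<close> and a functional \<open>T\<close> violating the double limit criterion. An
  amenable \<open>G\<close> satisfies Reiter's condition, and if \<open>h\<close> is an almost invariant probability function of
  finite support, then \<open>h\<^sup>1\<^sup>/\<^sup>q * (h\<^sup>1\<^sup>/\<^sup>p)\<^sup>\<or>\<close> is a finitely supported element of the unit
  ball of \<open>A\<^sub>p(G)\<close> close to 1 on a given finite set. These form an approximate identity \<open>(e\<^sub>k)\<close>,
  so the functionals \<open>u \<mapsto> T(e\<^sub>k u)\<close> lie in \<open>Z\<^sub>p\<close> and converge weak* to \<open>T\<close>, whence (ii) and (iii)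
  each imply the double limit criterion.\<close>

section \<open>Ultrafilter limits\<close>

text \<open>In (iii) no limit is assumed to exist. A free ultrafilter limit \<open>ulim\<close>
  exists for every bounded sequence, is linear and extends the ordinary limit, so a single swap
  identity for \<open>ulim\<close> serves both (ii) and (iii). The order of the indices in (iii) is
  the order in which an iterated limit is unravelled: outermost index first, each later one larger.
  For the converse, elements of the bidual are in general only limits of nets, whereas the criterion
  speaks of sequences. Sequences suffice because a fixed pair F, G and a fixed T involve only
  countably many functionals once the terms are chosen in alternation; likewise countability of G
  lets the approximate identity be a sequence. Helly's lemma and Reiter's condition both come from
  one finite-dimensional separation lemma. Since attainment of the infimum in \<open>Apnorm\<close>
  is not established, norm estimates use representations that are optimal up to some e > 0.\<close>

lemma ultrafilter_below:
  fixes F0 :: "'a filter"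
  assumes "F0 \<noteq> bot"
  shows "\<exists>U \<le> F0. U \<noteq> bot \<and> (\<forall>P. eventually P U \<or> eventually (\<lambda>x. \<not> P x) U)"
proof -
  define ev where "ev F = {P :: 'a \<Rightarrow> bool. eventually P F}" for F
  have ev_le: "ev F \<subseteq> ev F' \<longleftrightarrow> F' \<le> F" for F F'
    by (auto simp: ev_def le_filter_def)
  define A where "A = ev ` {F. F \<noteq> bot \<and> F \<le> F0}"
  \<comment> \<open>Zorn is applied to the sets of eventual predicates under inclusion: a finer
    filter has more of them. A nonempty chain is bounded by the infimum of its filters, which is
    proper because the chain is directed.\<close>
  have "\<exists>M\<in>A. \<forall>X\<in>A. M \<subseteq> X \<longrightarrow> X = M"
  proof (rule subset_Zorn)
    fix C assume C: "subset.chain A C"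
    show "\<exists>U\<in>A. \<forall>X\<in>C. X \<subseteq> U"
    proof (cases "C = {}")
      case True
      then show ?thesis using assms by (auto simp: A_def)
    next
      case False
      define B where "B = {F. F \<noteq> bot \<and> F \<le> F0 \<and> ev F \<in> C}"
      have CB: "\<exists>F\<in>B. X = ev F" if "X \<in> C" for X
        using that C unfolding subset.chain_def A_def B_def by blast
      have "B \<noteq> {}" using False CB by blast
      have dir: "\<exists>x\<in>B. x \<le> inf a b" if "a \<in> B" "b \<in> B" for a b
      proof -
        have "ev a \<subseteq> ev b \<or> ev b \<subseteq> ev a"
          using that subset.chain_total[OF C, of "ev a" "ev b"] by (auto simp: B_def)
        with that show ?thesis unfolding ev_le by (metis inf.absorb1 inf.absorb2 order_refl)
      qed
      have evI: "eventually P (Inf B) \<longleftrightarrow> (\<exists>b\<in>B. eventually P b)" for P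
        using eventually_INF_base[of B "\<lambda>b. b" P, OF \<open>B \<noteq> {}\<close> dir] by (simp only: image_ident)
      have "Inf B \<noteq> bot"
        using evI[of "\<lambda>_. False"] by (auto simp: B_def trivial_limit_def)
      moreover have "Inf B \<le> F0"
      proof -
        obtain b where b: "b \<in> B" using \<open>B \<noteq> {}\<close> by blast
        then have "Inf B \<le> b" by (rule Inf_lower)
        also have "b \<le> F0" using b by (simp add: B_def)
        finally show ?thesis .
      qed
      ultimately have "ev (Inf B) \<in> A" by (auto simp: A_def)
      moreover have "X \<subseteq> ev (Inf B)" if "X \<in> C" for X
        using CB[OF that] by (auto simp: ev_def evI)
      ultimately show ?thesis by blast
    qed
  qed
  then obtain U where U: "U \<noteq> bot" "U \<le> F0"
    and M: "\<forall>X\<in>A. ev U \<subseteq> X \<longrightarrow> X = ev U"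
    unfolding A_def by blast
  have max: "U \<le> F" if "F \<noteq> bot" "F \<le> F0" "F \<le> U" for F
  proof -
    have "ev F \<in> A" using that by (simp add: A_def)
    moreover have "ev U \<subseteq> ev F" using that by (simp only: ev_le)
    ultimately have "ev F \<subseteq> ev U" using M by blast
    then show ?thesis by (simp only: ev_le)
  qed
  have "eventually P U \<or> eventually (\<lambda>x. \<not> P x) U" for P
  proof (rule ccontr)
    assume n: "\<not> ?thesis"
    \<comment> \<open>The trace of \<open>U\<close> on \<open>P\<close> is proper because
      \<open>\<not> P\<close> is not eventual; by maximality it is no finer than \<open>U\<close>,
      so \<open>P\<close> is eventual.\<close>
    then have "inf U (principal {x. P x}) \<noteq> bot"
      by (simp add: trivial_limit_def eventually_inf_principal)
    then have "U \<le> inf U (principal {x. P x})"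
      by (rule max) (use U in \<open>auto intro: le_infI1\<close>)
    then have "eventually P U"
      by (simp add: le_principal)
    then show False using n by blast
  qed
  then show ?thesis using U by blast
qed

text \<open>Compactness only yields a cluster point. An ultrafilter that is not eventually inside a
  neighbourhood is eventually outside it, so the cluster point is a limit.\<close>

lemma ultrafilter_tendsto_compact:
  fixes f :: "'a \<Rightarrow> 'b::t2_space"
  assumes "U \<noteq> bot" "\<forall>P. eventually P U \<or> eventually (\<lambda>x. \<not> P x) U"
    and K: "compact K" "\<And>x. f x \<in> K"
  shows "\<exists>l\<in>K. (f \<longlongrightarrow> l) U"
proof -
  have "filtermap f U \<noteq> bot" using assms by (simp add: filtermap_bot_iff)
  then obtain l where l: "l \<in> K" "inf (nhds l) (filtermap f U) \<noteq> bot"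
    using K unfolding compact_filter by (force simp: eventually_filtermap)
  have "(f \<longlongrightarrow> l) U"
  proof (rule topological_tendstoI)
    fix S assume S: "open S" "l \<in> S"
    show "eventually (\<lambda>x. f x \<in> S) U"
    proof (rule ccontr)
      assume "\<not> ?thesis"
      then have "eventually (\<lambda>y. y \<notin> S) (filtermap f U)"
        using assms(2) by (auto simp: eventually_filtermap)
      moreover have "eventually (\<lambda>y. y \<in> S) (nhds l)"
        using S by (auto simp: eventually_nhds)
      ultimately have "eventually (\<lambda>y. False) (inf (nhds l) (filtermap f U))"
        unfolding eventually_inf by blast
      then show False using l by (simp add: trivial_limit_def)
    qed
  qed
  then show ?thesis using l by blast
qed

text \<open>Lying below \<open>sequentially\<close> makes the ultrafilter free: its limits extend
  ordinary limits, and its sets are unbounded, so that indices can later be chosen in increasing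
  order.\<close>

definition free_ultra :: "nat filter" where
  "free_ultra = (SOME U. U \<le> sequentially \<and> U \<noteq> bot \<and>
     (\<forall>P. eventually P U \<or> eventually (\<lambda>x. \<not> P x) U))"

lemma free_ultra:
  shows free_ultra_le: "free_ultra \<le> sequentially"
    and free_ultra_nontrivial [simp]: "free_ultra \<noteq> bot"
    and free_ultra_ultra: "\<forall>P. eventually P free_ultra \<or> eventually (\<lambda>x. \<not> P x) free_ultra"
  using someI_ex[OF ultrafilter_below[of sequentially]] by (auto simp: free_ultra_def)

definition ulim :: "(nat \<Rightarrow> 'b::t2_space) \<Rightarrow> 'b" where
  "ulim f = Lim free_ultra f"

lemma ulim_eqI: "(f \<longlongrightarrow> l) free_ultra \<Longrightarrow> ulim f = l"
  by (simp add: ulim_def tendsto_Lim)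

lemma ulim_LIMSEQ: "f \<longlonglongrightarrow> l \<Longrightarrow> ulim f = l"
  by (rule ulim_eqI) (rule tendsto_mono[OF free_ultra_le])

lemma bounded_tendsto_ulim:
  fixes f :: "nat \<Rightarrow> 'b::{heine_borel,real_normed_vector}"
  assumes "\<And>n. norm (f n) \<le> C"
  shows "(f \<longlongrightarrow> ulim f) free_ultra"
proof -
  have "\<exists>l\<in>cball 0 C. (f \<longlongrightarrow> l) free_ultra"
    by (rule ultrafilter_tendsto_compact[OF _ free_ultra_ultra]) (use assms in auto)
  then show ?thesis using ulim_eqI by metis
qed

lemma norm_ulim_le:
  fixes f :: "nat \<Rightarrow> 'b::{heine_borel,real_normed_vector}"
  assumes "\<And>n. norm (f n) \<le> C"
  shows "norm (ulim f) \<le> C"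
  by (rule tendsto_upperbound[OF tendsto_norm[OF bounded_tendsto_ulim[OF assms]]])
     (use assms in auto)

lemma eventually_free_ultra_gt: "eventually (\<lambda>n. n > N) free_ultra"
  using filter_leD[OF free_ultra_le eventually_gt_at_top] .

lemma free_ultra_gt_ex: "eventually P free_ultra \<Longrightarrow> \<exists>n>N. P n"
  using eventually_happens'[OF free_ultra_nontrivial eventually_conj[OF _ eventually_free_ultra_gt]]
  by blast

section \<open>Finite-dimensional separation\<close>

text \<open>The separating vector is \<open>z - c\<close> for a sufficiently good approximate minimiser \<open>c\<close> of the
  Euclidean distance to \<open>z\<close>, so neither closedness nor an index type is needed.\<close>

lemma approx_separation:
  fixes z :: "'i \<Rightarrow> real"
  assumes "finite I" "C \<noteq> {}"
    and conv: "\<And>c c' t. c \<in> C \<Longrightarrow> c' \<in> C \<Longrightarrow> 0 \<le> t \<Longrightarrow> t \<le> 1 \<Longrightarrow>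
                 (\<lambda>i. (1 - t) * c i + t * c' i) \<in> C"
    and bnd: "\<And>c i. c \<in> C \<Longrightarrow> i \<in> I \<Longrightarrow> \<bar>c i\<bar> \<le> B"
    and far: "\<And>c. c \<in> C \<Longrightarrow> \<exists>i\<in>I. e \<le> \<bar>c i - z i\<bar>" and "e > 0"
  shows "\<exists>w. \<exists>\<beta>>0. \<forall>c\<in>C. (\<Sum>i\<in>I. w i * c i) + \<beta> \<le> (\<Sum>i\<in>I. w i * z i)"
proof -
  define d where "d c = (\<Sum>i\<in>I. (c i - z i)\<^sup>2)" for c
  define D where "D = Inf (d ` C)"
  \<comment> \<open>\<open>R\<close> dominates the squared distance between any two points of
    \<open>C\<close>; adding 1 makes it a safe divisor.\<close>
  define R where "R = real (card I) * (2 * B)\<^sup>2 + 1"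
  have d_ge: "e\<^sup>2 \<le> d c" if "c \<in> C" for c
  proof -
    obtain i where i: "i \<in> I" "e \<le> \<bar>c i - z i\<bar>" using far[OF \<open>c \<in> C\<close>] by blast
    then have "e\<^sup>2 \<le> (c i - z i)\<^sup>2"
      using \<open>e > 0\<close> by (metis abs_le_square_iff abs_of_pos)
    also have "\<dots> \<le> d c" unfolding d_def using i assms(1)
      by (intro member_le_sum) auto
    finally show ?thesis .
  qed
  have bdd: "bdd_below (d ` C)" using d_ge by (intro bdd_belowI2)
  have D_le: "D \<le> d c" if "c \<in> C" for c
    unfolding D_def using that bdd by (intro cInf_lower) auto
  have "e\<^sup>2 \<le> D" unfolding D_def using assms(2) d_ge by (intro cInf_greatest) auto
  have "R \<ge> 1" by (simp add: R_def)
  \<comment> \<open>A move from the approximate minimiser \<open>c\<close> by the fraction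
    \<open>t\<close> towards any \<open>c'\<close> changes \<open>d\<close> by a linear and a
    quadratic term. This \<open>t\<close> keeps the quadratic term below
    \<open>t * (e\<^sup>2 / 2)\<close>, which is also the defect tolerated in the minimality of
    \<open>c\<close>. Together they cost \<open>e\<^sup>2 / 2\<close> of the gap
    \<open>e\<^sup>2 \<le> d c\<close>.\<close>
  define t where "t = min 1 (e\<^sup>2 / (2 * R))"
  have t: "0 < t" "t \<le> 1" "t * R \<le> e\<^sup>2 / 2"
    using \<open>e > 0\<close> \<open>R \<ge> 1\<close> by (auto simp: t_def min_def field_simps)
  have "\<exists>x\<in>d ` C. x < D + t * (e\<^sup>2 / 2)"
    unfolding D_def using assms(2) bdd t \<open>e > 0\<close> by (intro cInf_lessD) (auto simp: cInf_less_iff)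
  then obtain c where c: "c \<in> C" "d c < D + t * (e\<^sup>2 / 2)" by blast
  define w where "w i = z i - c i" for i
  have "(\<Sum>i\<in>I. w i * c' i) + e\<^sup>2 / 2 \<le> (\<Sum>i\<in>I. w i * z i)" if c': "c' \<in> C" for c'
  proof -
    have "D \<le> d (\<lambda>i. (1 - t) * c i + t * c' i)"
      by (rule D_le[OF conv]) (use c c' t in auto)
    also have "\<dots> = (\<Sum>i\<in>I. (c i - z i)\<^sup>2 - 2 * t * (w i * (c' i - c i)) + t\<^sup>2 * (c' i - c i)\<^sup>2)"
      unfolding d_def w_def by (intro sum.cong refl) (simp add: power2_eq_square algebra_simps)
    also have "\<dots> = d c - 2 * t * (\<Sum>i\<in>I. w i * (c' i - c i)) + t\<^sup>2 * (\<Sum>i\<in>I. (c' i - c i)\<^sup>2)"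
      by (simp add: sum.distrib sum_subtractf sum_distrib_left d_def)
    also have "(\<Sum>i\<in>I. (c' i - c i)\<^sup>2) \<le> real (card I) * (2 * B)\<^sup>2"
    proof (rule sum_bounded_above)
      fix i assume i: "i \<in> I"
      show "(c' i - c i)\<^sup>2 \<le> (2 * B)\<^sup>2"
        using bnd[OF c(1) i] bnd[OF c' i] by (intro abs_le_square_iff[THEN iffD1]) auto
    qed
    then have "t\<^sup>2 * (\<Sum>i\<in>I. (c' i - c i)\<^sup>2) \<le> t\<^sup>2 * R"
      by (intro mult_left_mono) (auto simp: R_def)
    also have "t\<^sup>2 * R \<le> t * (e\<^sup>2 / 2)" using t by (simp add: power2_eq_square)
    finally have "2 * t * (\<Sum>i\<in>I. w i * (c' i - c i)) < 2 * t * (e\<^sup>2 / 2)"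
      using c by simp
    then have "(\<Sum>i\<in>I. w i * (c' i - c i)) + e\<^sup>2 / 2 \<le> e\<^sup>2" using t by simp
    also have "e\<^sup>2 \<le> d c" using d_ge c by blast
    also have "d c = (\<Sum>i\<in>I. w i * (z i - c i))"
      by (simp add: d_def w_def power2_eq_square algebra_simps)
    finally show ?thesis by (simp add: right_diff_distrib sum_subtractf)
  qed
  moreover have "e\<^sup>2 / 2 > 0" using \<open>e > 0\<close> by simp
  ultimately show ?thesis by blast
qed

section \<open>The Hoelder inequality for infinite sums\<close>

text \<open>Young's inequality, taken termwise, gives summability; applied to the factors divided by
  their norms it sums to 1/p + 1/q = 1. A factor of norm zero vanishes on \<open>A\<close> and is
  treated apart.\<close>

lemma Holder_infsum:
  fixes a b :: "'a \<Rightarrow> real"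
  assumes p: "1 < p" "1 < q" "1/p + 1/q = 1"
    and a: "\<And>x. 0 \<le> a x" "(\<lambda>x. a x powr p) summable_on A"
    and b: "\<And>x. 0 \<le> b x" "(\<lambda>x. b x powr q) summable_on A"
  shows "(\<lambda>x. a x * b x) summable_on A"
    and "(\<Sum>\<^sub>\<infinity>x\<in>A. a x * b x) \<le>
           (\<Sum>\<^sub>\<infinity>x\<in>A. a x powr p) powr (1/p) * (\<Sum>\<^sub>\<infinity>x\<in>A. b x powr q) powr (1/q)"
proof -
  have Young: "a x * b x \<le> a x powr p / p + b x powr q / q" for x
    using Youngs_inequality[of p q "a x" "b x"] p a b by auto
  have s: "(\<lambda>x. a x powr p / p + b x powr q / q) summable_on A"
    using a b by (auto intro!: summable_on_add summable_on_cmult_left simp: divide_inverse)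
  show sm: "(\<lambda>x. a x * b x) summable_on A"
    by (rule summable_on_comparison_test[OF s Young]) (use a b in auto)
  define S where "S = (\<Sum>\<^sub>\<infinity>x\<in>A. a x powr p) powr (1/p)"
  define T where "T = (\<Sum>\<^sub>\<infinity>x\<in>A. b x powr q) powr (1/q)"
  have S: "S powr p = (\<Sum>\<^sub>\<infinity>x\<in>A. a x powr p)" "S \<ge> 0"
    using p by (auto simp: S_def powr_powr infsum_nonneg)
  have T: "T powr q = (\<Sum>\<^sub>\<infinity>x\<in>A. b x powr q)" "T \<ge> 0"
    using p by (auto simp: T_def powr_powr infsum_nonneg)
  have "(\<Sum>\<^sub>\<infinity>x\<in>A. a x * b x) \<le> S * T"
  proof (cases "S = 0 \<or> T = 0")
    case True
    have "a x * b x = 0" if "x \<in> A" for x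
    proof (cases "S = 0")
      case True
      then have "(\<Sum>\<^sub>\<infinity>x\<in>A. a x powr p) = 0" using S p by simp
      from nonneg_infsum_le_0D[OF eq_refl[OF this] a(2) _ that] show ?thesis by simp
    next
      case False
      then have "(\<Sum>\<^sub>\<infinity>x\<in>A. b x powr q) = 0" using T p True by simp
      from nonneg_infsum_le_0D[OF eq_refl[OF this] b(2) _ that] show ?thesis by simp
    qed
    then have "(\<Sum>\<^sub>\<infinity>x\<in>A. a x * b x) = 0" by (simp add: infsum_0)
    then show ?thesis using S T by simp
  next
    case False
    then have pos: "S > 0" "T > 0" using S T by auto
    have le: "a x * b x / (S * T) \<le> a x powr p * (inverse (S powr p) / p) + b x powr q * (inverse (T powr q) / q)" for x
    proof -
      have "(a x / S) powr p = a x powr p * inverse (S powr p)"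
           "(b x / T) powr q = b x powr q * inverse (T powr q)"
        using a(1)[of x] b(1)[of x] pos by (auto simp: powr_divide simp flip: divide_inverse)
      then show ?thesis
        using Youngs_inequality[of p q "a x / S" "b x / T"] p a(1)[of x] b(1)[of x] pos
        by simp
    qed
    have "(\<Sum>\<^sub>\<infinity>x\<in>A. a x * b x) / (S * T) = (\<Sum>\<^sub>\<infinity>x\<in>A. a x * b x / (S * T))"
      using infsum_cmult_left[OF sm, of "inverse (S * T)"] sm by (simp add: divide_inverse)
    also have "\<dots> \<le> (\<Sum>\<^sub>\<infinity>x\<in>A. a x powr p * (inverse (S powr p) / p) + b x powr q * (inverse (T powr q) / q))"
      by (intro infsum_mono le summable_on_add summable_on_cmult_left a b)
         (use summable_on_cmult_left[OF sm, of "inverse (S * T)"] in \<open>simp add: divide_inverse\<close>)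
    also have "\<dots> = S powr p * (inverse (S powr p) / p) + T powr q * (inverse (T powr q) / q)"
      by (simp only: infsum_add[OF summable_on_cmult_left[OF a(2)] summable_on_cmult_left[OF b(2)]]
            infsum_cmult_left' S(1) T(1))
    also have "\<dots> = 1"
    proof -
      have "S powr p \<noteq> 0" "T powr q \<noteq> 0" using pos by auto
      then show ?thesis using p by simp
    qed
    finally show ?thesis using pos by (simp add: field_simps)
  qed
  then show "(\<Sum>\<^sub>\<infinity>x\<in>A. a x * b x) \<le>
           (\<Sum>\<^sub>\<infinity>x\<in>A. a x powr p) powr (1/p) * (\<Sum>\<^sub>\<infinity>x\<in>A. b x powr q) powr (1/q)"
    by (simp add: S_def T_def)
qed

section \<open>The Herz algebra\<close>

lemma lpnorm_nonneg [simp]: "0 \<le> lpnorm r f"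
  by (simp add: lpnorm_def)

lemma lpnorm_powr: "0 < r \<Longrightarrow> lpnorm r f powr r = (\<Sum>\<^sub>\<infinity>x. norm (f x) powr r)"
  by (simp add: lpnorm_def powr_powr infsum_nonneg)

lemma lp_cmult: "lp r f \<Longrightarrow> lp r (\<lambda>x. c * f x)"
  by (simp add: lp_def norm_mult powr_mult summable_on_cmult_right)

lemma lpnorm_cmult: "0 < r \<Longrightarrow> lpnorm r (\<lambda>x. c * f x) = norm c * lpnorm r f"
  by (simp add: lpnorm_def norm_mult powr_mult infsum_cmult_right' infsum_nonneg powr_powr)

lemma lp_zero [simp]: "lp r (\<lambda>x. 0)"
  by (simp add: lp_def)

lemma lpnorm_zero [simp]: "lpnorm r (\<lambda>x. 0) = 0"
  by (simp add: lpnorm_def)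

lemma lp_finite_support: "finite {x. f x \<noteq> 0} \<Longrightarrow> lp r f"
  unfolding lp_def by (rule finite_nonzero_values_imp_summable_on) (simp add: finite_subset)

lemma conv_fcheck: "conv g (fcheck f) x = (\<Sum>\<^sub>\<infinity>y. g y * f (- x + y))"
  by (simp add: conv_def fcheck_def minus_add)

lemma conv_zero [simp]: "conv (\<lambda>_. 0) h x = 0" "conv g (fcheck (\<lambda>_. 0)) x = 0"
  by (simp_all add: conv_def fcheck_def)

section \<open>Unconditional sums over products, disjoint unions and countable index types\<close>

lemma bij_plus_left: "bij (\<lambda>y::'g::group_add. c + y)"
  by (rule bij_betw_byWitness[where f' = "\<lambda>y. - c + y"]) (auto simp flip: add.assoc)

lemma has_sum_product:
  fixes a b :: "_ \<Rightarrow> 'c::{banach,real_normed_field}"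
  assumes "(\<lambda>x. norm (a x)) summable_on A" "(\<lambda>x. norm (b x)) summable_on B"
  shows "((\<lambda>(x, y). a x * b y) has_sum (infsum a A * infsum b B)) (A \<times> B)"
proof -
  have "(\<lambda>z. norm (a (fst z) * b (snd z))) summable_on A \<times> B"
    unfolding Infinite_Sum.abs_summable_on_Sigma_iff
    using assms by (auto simp: norm_mult abs_mult infsum_cmult_right' intro!: summable_on_cmult_right
        summable_on_cmult_left)
  then have s: "(\<lambda>z. a (fst z) * b (snd z)) summable_on A \<times> B"
    by (rule abs_summable_summable)
  moreover have "infsum (\<lambda>z. a (fst z) * b (snd z)) (A \<times> B) = infsum a A * infsum b B"
    unfolding infsum_Sigma_banach[OF s, symmetric] by (simp add: infsum_cmult_right' infsum_cmult_left')
  ultimately show ?thesis by (simp add: has_sum_iff case_prod_unfold)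
qed

text \<open>The substitution z = y + t turns the offset t into a summation variable. In this form a
  product of two convolution values becomes a sum of convolution values.\<close>

lemma has_sum_twisted_product:
  fixes a b :: "'g::group_add \<Rightarrow> 'c::{banach,real_normed_field}"
  assumes "(\<lambda>y. norm (a y)) summable_on UNIV" "(\<lambda>y. norm (b y)) summable_on UNIV"
  shows "((\<lambda>(t, y). a y * b (y + t)) has_sum (infsum a UNIV * infsum b UNIV)) (UNIV \<times> UNIV)"
proof -
  have bij: "bij_betw (\<lambda>(t, y). (y, y + t)) (UNIV \<times> UNIV) (UNIV \<times> (UNIV :: 'g set))"
    by (rule bij_betw_byWitness[where f' = "\<lambda>(y, z). (- y + z, y)"]) (auto simp flip: add.assoc)
  show ?thesis
    using has_sum_reindex_bij_betw[OF bij, of "\<lambda>(x, y). a x * b y"] has_sum_product[OF assms]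
    by (simp add: case_prod_unfold)
qed

lemma has_sum_case_sum:
  fixes a :: "'a \<Rightarrow> 'c::{topological_comm_monoid_add}"
  assumes "(a has_sum s) UNIV" "(b has_sum t) UNIV"
  shows "(case_sum a b has_sum (s + t)) UNIV"
proof -
  have "(case_sum a b has_sum s) (range Inl)" "(case_sum a b has_sum t) (range Inr)"
    using assms by (simp_all add: has_sum_reindex comp_def)
  moreover have "range Inl \<inter> range Inr = {}" by auto
  ultimately show ?thesis unfolding UNIV_sum by (rule has_sum_Un_disjoint)
qed

text \<open>\<open>Ap_rep\<close> is indexed by \<open>nat\<close>, while sums and products of
  representations live on disjoint unions and triples. Positions outside the range of
  \<open>to_nat\<close> are filled with zeros, which do not affect the series.\<close>

lemma has_sum_countable_imp_sums:
  fixes h :: "'i::countable \<Rightarrow> 'c::{topological_comm_monoid_add,t2_space}"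
  assumes "(h has_sum s) UNIV"
  shows "(\<lambda>n. if n \<in> range (to_nat :: 'i \<Rightarrow> nat) then h (from_nat n) else 0) sums s"
proof (rule has_sum_imp_sums)
  have "((\<lambda>n. if n \<in> range (to_nat :: 'i \<Rightarrow> nat) then h (from_nat n) else 0) has_sum s) (range (to_nat :: 'i \<Rightarrow> nat))"
    using assms by (subst has_sum_reindex) (auto simp: comp_def)
  then show "((\<lambda>n. if n \<in> range (to_nat :: 'i \<Rightarrow> nat) then h (from_nat n) else 0) has_sum s) UNIV"
    by (rule has_sum_cong_neutral[THEN iffD1, rotated -1]) auto
qed

section \<open>Representations and the norm of A_p\<close>

context
  fixes p :: real
  assumes p1: "1 < p"
begin

lemma conj_exp_gt1: "1 < conj_exp p"
  using p1 by (simp add: conj_exp_def field_simps)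

lemma conj_exp_sum: "1 / p + 1 / conj_exp p = 1"
  using p1 by (simp add: conj_exp_def field_simps)

text \<open>Hoelder's inequality for \<open>g\<close> and a left translate of \<open>f\<close>; the
  translation is a bijection of the group and preserves the p-norm.\<close>

lemma
  fixes f g :: "'g::group_add \<Rightarrow> complex"
  assumes "lp p f" "lp (conj_exp p) g"
  shows conv_abs_summable: "(\<lambda>y. norm (g y * f (- x + y))) summable_on UNIV"
    and norm_conv_le: "norm (conv g (fcheck f) x) \<le> lpnorm p f * lpnorm (conj_exp p) g"
proof -
  have s: "(\<lambda>y. norm (f (- x + y)) powr p) summable_on UNIV"
    using summable_on_reindex_bij_betw[OF bij_plus_left[of "- x"], of "\<lambda>y. norm (f y) powr p"] assms
    by (simp add: lp_def)
  have i: "(\<Sum>\<^sub>\<infinity>y. norm (f (- x + y)) powr p) = (\<Sum>\<^sub>\<infinity>y. norm (f y) powr p)"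
    using infsum_reindex_bij_betw[OF bij_plus_left[of "- x"], of "\<lambda>y. norm (f y) powr p"] by simp
  have q: "(\<lambda>y. norm (g y) powr conj_exp p) summable_on UNIV"
    using assms by (simp add: lp_def)
  note H = Holder_infsum[OF p1 conj_exp_gt1 conj_exp_sum norm_ge_zero s norm_ge_zero q]
  show *: "(\<lambda>y. norm (g y * f (- x + y))) summable_on UNIV"
    using H(1) by (simp add: norm_mult mult.commute)
  have "norm (conv g (fcheck f) x) \<le> (\<Sum>\<^sub>\<infinity>y. norm (g y * f (- x + y)))"
    unfolding conv_fcheck by (rule norm_infsum_bound[OF *])
  also have "\<dots> \<le> lpnorm p f * lpnorm (conj_exp p) g"
    using H(2) by (simp add: lpnorm_def norm_mult mult.commute i)
  finally show "norm (conv g (fcheck f) x) \<le> lpnorm p f * lpnorm (conj_exp p) g" .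
qed

lemma Ap_countable_repI:
  fixes f g :: "'i::countable \<Rightarrow> 'g::group_add \<Rightarrow> complex"
  assumes fg: "\<And>i. lp p (f i)" "\<And>i. lp (conj_exp p) (g i)"
    and s: "((\<lambda>i. lpnorm p (f i) * lpnorm (conj_exp p) (g i)) has_sum s) UNIV"
    and u: "\<And>x. ((\<lambda>i. conv (g i) (fcheck (f i)) x) has_sum u x) UNIV"
  shows "u \<in> Ap p" and "Apnorm p u \<le> s"
proof -
  define f' where "f' n = (if n \<in> range (to_nat :: 'i \<Rightarrow> nat) then f (from_nat n) else (\<lambda>_. 0))" for n
  define g' where "g' n = (if n \<in> range (to_nat :: 'i \<Rightarrow> nat) then g (from_nat n) else (\<lambda>_. 0))" for n
  have 1: "(\<lambda>n. lpnorm p (f' n) * lpnorm (conj_exp p) (g' n)) sums s"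
    using has_sum_countable_imp_sums[OF s]
    by (rule back_subst[of "\<lambda>h. h sums s"]) (auto simp: f'_def g'_def fun_eq_iff)
  have 2: "(\<lambda>n. conv (g' n) (fcheck (f' n)) x) sums u x" for x
    using has_sum_countable_imp_sums[OF u[of x]]
    by (rule back_subst[of "\<lambda>h. h sums u x"]) (auto simp: f'_def g'_def fun_eq_iff)
  have rep: "Ap_rep p u f' g'"
    unfolding Ap_rep_def using fg 1 2 by (auto simp: f'_def g'_def sums_iff)
  then show "u \<in> Ap p" by (auto simp: Ap_def)
  have "Apnorm p u \<le> (\<Sum>n. lpnorm p (f' n) * lpnorm (conj_exp p) (g' n))"
    unfolding Apnorm_def
  proof (rule cInf_lower)
    show "bdd_below {\<Sum>i. lpnorm p (f i) * lpnorm (conj_exp p) (g i) |f g. Ap_rep p u f g}"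
      by (rule bdd_belowI[of _ 0]) (auto simp: Ap_rep_def intro!: suminf_nonneg)
  qed (use rep in blast)
  then show "Apnorm p u \<le> s" using 1 by (simp add: sums_iff)
qed

text \<open>The slack \<open>e\<close> stands in for a minimiser. The series are turned into
  unconditional sums so that they can be regrouped: the norm series by nonnegativity, the pointwise
  series because the norm series dominates it.\<close>

lemma Ap_repE:
  fixes u :: "'g::group_add \<Rightarrow> complex"
  assumes "u \<in> Ap p" "0 < e"
  obtains f g s where "\<And>i::nat. lp p (f i)" "\<And>i. lp (conj_exp p) (g i)"
    "((\<lambda>i. lpnorm p (f i) * lpnorm (conj_exp p) (g i)) has_sum s) UNIV" "s < Apnorm p u + e"
    "\<And>x. ((\<lambda>i. conv (g i) (fcheck (f i)) x) has_sum u x) UNIV"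
proof -
  let ?S = "{\<Sum>i. lpnorm p (f i) * lpnorm (conj_exp p) (g i) |f g. Ap_rep p u f g}"
  have "?S \<noteq> {}" using assms by (auto simp: Ap_def)
  then have "\<exists>s\<in>?S. s < Apnorm p u + e"
    using assms(2) by (intro cInf_lessD) (auto simp: Apnorm_def)
  then obtain f g where rep: "Ap_rep p u f g"
    and less: "(\<Sum>i. lpnorm p (f i) * lpnorm (conj_exp p) (g i)) < Apnorm p u + e" by auto
  have fg: "lp p (f i)" "lp (conj_exp p) (g i)" for i using rep by (auto simp: Ap_rep_def)
  have sm: "summable (\<lambda>i. lpnorm p (f i) * lpnorm (conj_exp p) (g i))"
    using rep by (simp add: Ap_rep_def)
  then have s: "((\<lambda>i. lpnorm p (f i) * lpnorm (conj_exp p) (g i)) has_sum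
        (\<Sum>i. lpnorm p (f i) * lpnorm (conj_exp p) (g i))) UNIV"
    by (intro sums_nonneg_imp_has_sum) (auto simp: summable_sums)
  have "((\<lambda>i. conv (g i) (fcheck (f i)) x) has_sum u x) UNIV" for x
  proof -
    have "summable (\<lambda>i. norm (conv (g i) (fcheck (f i)) x))"
      by (rule summable_comparison_test'[OF sm, of 0]) (auto intro!: norm_conv_le fg)
    from norm_summable_imp_has_sum[OF this summable_sums[OF summable_norm_cancel[OF this]]]
    show ?thesis using rep by (simp add: Ap_rep_def)
  qed
  with fg s less show thesis using that by blast
qed

lemma Apnorm_nonneg: "u \<in> Ap p \<Longrightarrow> 0 \<le> Apnorm p u"
  unfolding Apnorm_def by (rule cInf_greatest) (auto simp: Ap_def Ap_rep_def intro!: suminf_nonneg)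

lemma norm_le_Apnorm:
  fixes u :: "'g::group_add \<Rightarrow> complex"
  assumes "u \<in> Ap p"
  shows "norm (u x) \<le> Apnorm p u"
proof (rule field_le_epsilon)
  fix e :: real assume e0: "0 < e"
  obtain f g s where r: "\<And>i::nat. lp p (f i)" "\<And>i. lp (conj_exp p) (g i)"
    "((\<lambda>i. lpnorm p (f i) * lpnorm (conj_exp p) (g i)) has_sum s) UNIV" "s < Apnorm p u + e"
    "\<And>x. ((\<lambda>i. conv (g i) (fcheck (f i)) x) has_sum u x) UNIV"
    by (rule Ap_repE[OF assms e0]) (rule that)
  have "norm (u x) \<le> s"
    by (rule norm_infsum_le[OF r(5) r(3)]) (auto intro!: norm_conv_le r(1,2))
  then show "norm (u x) \<le> Apnorm p u + e" using r by simp
qed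

lemma
  fixes u v :: "'g::group_add \<Rightarrow> complex"
  assumes "u \<in> Ap p" "v \<in> Ap p"
  shows Ap_add: "(\<lambda>x. u x + v x) \<in> Ap p"
    and Apnorm_add: "Apnorm p (\<lambda>x. u x + v x) \<le> Apnorm p u + Apnorm p v"
proof -
  have *: "(\<lambda>x. u x + v x) \<in> Ap p \<and> Apnorm p (\<lambda>x. u x + v x) \<le> Apnorm p u + Apnorm p v + e"
    if "0 < e" for e
  proof -
    have e0: "0 < e/2" using that by simp
    obtain f g s where r: "\<And>i::nat. lp p (f i)" "\<And>i. lp (conj_exp p) (g i)"
      "((\<lambda>i. lpnorm p (f i) * lpnorm (conj_exp p) (g i)) has_sum s) UNIV" "s < Apnorm p u + e/2"
      "\<And>x. ((\<lambda>i. conv (g i) (fcheck (f i)) x) has_sum u x) UNIV" by (rule Ap_repE[OF assms(1) e0]) (rule that)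
    obtain h k t where r': "\<And>i::nat. lp p (h i)" "\<And>i. lp (conj_exp p) (k i)"
      "((\<lambda>i. lpnorm p (h i) * lpnorm (conj_exp p) (k i)) has_sum t) UNIV" "t < Apnorm p v + e/2"
      "\<And>x. ((\<lambda>i. conv (k i) (fcheck (h i)) x) has_sum v x) UNIV" by (rule Ap_repE[OF assms(2) e0]) (rule that)
    \<comment> \<open>The two representations are laid side by side, so their costs add; hence half
      of the slack for each.\<close>
    let ?F = "case_sum f h" and ?G = "case_sum g k"
    have 1: "lp p (?F i)" "lp (conj_exp p) (?G i)" for i using r r' by (auto split: sum.split)
    have 2: "((\<lambda>i. lpnorm p (?F i) * lpnorm (conj_exp p) (?G i)) has_sum (s + t)) UNIV"
      by (rule has_sum_cong[THEN iffD1, OF _ has_sum_case_sum[OF r(3) r'(3)]]) (auto split: sum.split)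
    have 3: "((\<lambda>i. conv (?G i) (fcheck (?F i)) x) has_sum (u x + v x)) UNIV" for x
      by (rule has_sum_cong[THEN iffD1, OF _ has_sum_case_sum[OF r(5) r'(5)]]) (auto split: sum.split)
    show ?thesis using Ap_countable_repI[OF 1 2 3] r(4) r'(4) by auto
  qed
  show "(\<lambda>x. u x + v x) \<in> Ap p" using *[of 1] by simp
  show "Apnorm p (\<lambda>x. u x + v x) \<le> Apnorm p u + Apnorm p v"
  proof (rule field_le_epsilon)
    fix e :: real assume "0 < e"
    from *[OF this] show "Apnorm p (\<lambda>x. u x + v x) \<le> Apnorm p u + Apnorm p v + e" by blast
  qed
qed

lemma Ap_conv:
  fixes f g :: "'g::group_add \<Rightarrow> complex"
  assumes "lp p f" "lp (conj_exp p) g"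
  shows "conv g (fcheck f) \<in> Ap p" "Apnorm p (conv g (fcheck f)) \<le> lpnorm p f * lpnorm (conj_exp p) g"
proof -
  have a: "((\<lambda>i::unit. h) has_sum h) UNIV" for h :: "'c::{topological_comm_monoid_add}"
    by (rule has_sum_finiteI) (auto simp: UNIV_unit)
  show "conv g (fcheck f) \<in> Ap p" "Apnorm p (conv g (fcheck f)) \<le> lpnorm p f * lpnorm (conj_exp p) g"
    using Ap_countable_repI[of "\<lambda>_::unit. f" "\<lambda>_. g", OF assms a a] by auto
qed

lemma
  shows Ap_zero [simp]: "(\<lambda>_::'g::group_add. 0) \<in> Ap p"
    and Apnorm_zero [simp]: "Apnorm p (\<lambda>_::'g. 0) = 0"
proof -
  have e: "conv (\<lambda>_. 0) (fcheck (\<lambda>_::'g. 0)) = (\<lambda>_. 0)" by auto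
  note z = Ap_conv[of "\<lambda>_::'g. 0" "\<lambda>_. 0", unfolded e, simplified]
  show "(\<lambda>_::'g. 0) \<in> Ap p" by (rule z(1))
  show "Apnorm p (\<lambda>_::'g. 0) = 0" using z(2) Apnorm_nonneg[OF z(1)] by simp
qed

lemma
  fixes u :: "'g::group_add \<Rightarrow> complex"
  assumes "u \<in> Ap p"
  shows Ap_cmult: "(\<lambda>x. c * u x) \<in> Ap p"
    and Apnorm_cmult_le: "Apnorm p (\<lambda>x. c * u x) \<le> norm c * Apnorm p u"
proof -
  have *: "(\<lambda>x. c * u x) \<in> Ap p \<and> Apnorm p (\<lambda>x. c * u x) \<le> norm c * (Apnorm p u + e)"
    if e0: "0 < e" for e
  proof -
    obtain f g s where r: "\<And>i::nat. lp p (f i)" "\<And>i. lp (conj_exp p) (g i)"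
      "((\<lambda>i. lpnorm p (f i) * lpnorm (conj_exp p) (g i)) has_sum s) UNIV" "s < Apnorm p u + e"
      "\<And>x. ((\<lambda>i. conv (g i) (fcheck (f i)) x) has_sum u x) UNIV" by (rule Ap_repE[OF assms e0]) (rule that)
    have 2: "((\<lambda>i. lpnorm p (\<lambda>x. c * f i x) * lpnorm (conj_exp p) (g i)) has_sum (norm c * s)) UNIV"
      using has_sum_cmult_right[OF r(3), of "norm c"] p1 by (simp add: lpnorm_cmult mult.assoc)
    have 3: "((\<lambda>i. conv (g i) (fcheck (\<lambda>x. c * f i x)) x) has_sum (c * u x)) UNIV" for x
      using has_sum_cmult_right[OF r(5), of c x]
      by (simp add: conv_def fcheck_def mult.left_commute infsum_cmult_right')
    have "norm c * s \<le> norm c * (Apnorm p u + e)" using r by (intro mult_left_mono) auto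
    with Ap_countable_repI[OF lp_cmult[OF r(1)] r(2) 2 3] show ?thesis by auto
  qed
  show "(\<lambda>x. c * u x) \<in> Ap p" using *[of 1] by simp
  show "Apnorm p (\<lambda>x. c * u x) \<le> norm c * Apnorm p u"
  proof (cases "c = 0")
    case False
    show ?thesis
    proof (rule field_le_epsilon)
      fix e :: real assume "0 < e"
      with *[of "e / norm c"] False show "Apnorm p (\<lambda>x. c * u x) \<le> norm c * Apnorm p u + e"
        by (simp add: distrib_left)
    qed
  qed simp
qed

section \<open>Submultiplicativity of the norm\<close>

text \<open>The substitution \<open>z = y + t\<close> in the product of the two convolution sums
  writes \<open>(g * f\<^sup>\<or>) (g' * f'\<^sup>\<or>)\<close> as \<open>\<Sum>t. G t * (F t)\<^sup>\<or>\<close>;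
  the Hoelder inequality in \<open>t\<close> then gives submultiplicativity of the norm.\<close>

lemma
  fixes f f' g g' :: "'g::group_add \<Rightarrow> complex"
  assumes "lp p f" "lp p f'" "lp (conj_exp p) g" "lp (conj_exp p) g'"
  defines "F \<equiv> \<lambda>t y. f y * f' (y + t)" and "G \<equiv> \<lambda>t y. g y * g' (y + t)"
  shows lp_twisted_product: "lp p (F t)" "lp (conj_exp p) (G t)"
    and summable_twisted_product: "(\<lambda>t. lpnorm p (F t) * lpnorm (conj_exp p) (G t)) summable_on UNIV"
    and infsum_twisted_product: "(\<Sum>\<^sub>\<infinity>t. lpnorm p (F t) * lpnorm (conj_exp p) (G t))
          \<le> (lpnorm p f * lpnorm (conj_exp p) g) * (lpnorm p f' * lpnorm (conj_exp p) g')"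
    and conv_twisted_product: "((\<lambda>t. conv (G t) (fcheck (F t)) x) has_sum
          (conv g (fcheck f) x * conv g' (fcheck f') x)) UNIV"
proof -
  \<comment> \<open>By Fubini the r-th powers of the slice norms sum over \<open>t\<close> exactly
    to the r-th power of the product of the norms. The slice norms are thus themselves r-summable in
    \<open>t\<close>, as the second use of Hoelder's inequality requires.\<close>
  have *: "lp r (\<lambda>y. h y * h' (y + t))"
    "((\<lambda>t. lpnorm r (\<lambda>y. h y * h' (y + t)) powr r) has_sum (lpnorm r h * lpnorm r h') powr r) UNIV"
    if "1 < r" "lp r h" "lp r h'" for r t and h h' :: "'g \<Rightarrow> complex"
  proof -
    have s: "((\<lambda>(t, y). norm (h y) powr r * norm (h' (y + t)) powr r) has_sum
        (\<Sum>\<^sub>\<infinity>y. norm (h y) powr r) * (\<Sum>\<^sub>\<infinity>y. norm (h' y) powr r)) (UNIV \<times> UNIV)"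
      using that by (intro has_sum_twisted_product) (auto simp: lp_def)
    have s1: "(\<lambda>y. norm (h y) powr r * norm (h' (y + t)) powr r) summable_on UNIV" for t
      using summable_on_SigmaD1[OF has_sum_imp_summable[OF s], of t] by simp
    then show "lp r (\<lambda>y. h y * h' (y + t))" by (simp add: lp_def norm_mult powr_mult)
    have "((\<lambda>t. \<Sum>\<^sub>\<infinity>y. norm (h y) powr r * norm (h' (y + t)) powr r) has_sum
        (\<Sum>\<^sub>\<infinity>y. norm (h y) powr r) * (\<Sum>\<^sub>\<infinity>y. norm (h' y) powr r)) UNIV"
      using has_sum_SigmaD[OF s, of "\<lambda>t. \<Sum>\<^sub>\<infinity>y. norm (h y) powr r * norm (h' (y + t)) powr r"] s1
      by (simp add: has_sum_infsum)
    then show "((\<lambda>t. lpnorm r (\<lambda>y. h y * h' (y + t)) powr r) has_sum (lpnorm r h * lpnorm r h') powr r) UNIV"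
      using that by (simp add: lpnorm_powr powr_mult norm_mult)
  qed
  note F = *[OF p1 assms(1,2)] and G = *[OF conj_exp_gt1 assms(3,4)]
  show "lp p (F t)" "lp (conj_exp p) (G t)" unfolding F_def G_def by (rule F(1), rule G(1))
  note H = Holder_infsum[OF p1 conj_exp_gt1 conj_exp_sum lpnorm_nonneg has_sum_imp_summable[OF F(2)]
      lpnorm_nonneg has_sum_imp_summable[OF G(2)]]
  show "(\<lambda>t. lpnorm p (F t) * lpnorm (conj_exp p) (G t)) summable_on UNIV"
    unfolding F_def G_def by (rule H(1))
  show "(\<Sum>\<^sub>\<infinity>t. lpnorm p (F t) * lpnorm (conj_exp p) (G t))
          \<le> (lpnorm p f * lpnorm (conj_exp p) g) * (lpnorm p f' * lpnorm (conj_exp p) g')"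
    unfolding F_def G_def using H(2) infsumI[OF F(2)] infsumI[OF G(2)] p1 conj_exp_gt1
    by (simp add: powr_powr mult_ac)
  \<comment> \<open>\<open>a\<close> and \<open>b\<close> are the summands of the two convolutions
    at \<open>x\<close>, and \<open>a y * b (y + t)\<close> is the y-th summand of the convolution
    built from the slices \<open>G t\<close> and \<open>F t\<close>.\<close>
  define a where "a y = g y * f (- x + y)" for y
  define b where "b y = g' y * f' (- x + y)" for y
  have ab: "(\<lambda>y. norm (a y)) summable_on UNIV" "(\<lambda>y. norm (b y)) summable_on UNIV"
    unfolding a_def b_def by (rule conv_abs_summable[OF assms(1,3)], rule conv_abs_summable[OF assms(2,4)])
  note s = has_sum_twisted_product[OF ab]
  have "((\<lambda>t. \<Sum>\<^sub>\<infinity>y. a y * b (y + t)) has_sum (infsum a UNIV * infsum b UNIV)) UNIV"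
    using has_sum_SigmaD[OF s, of "\<lambda>t. \<Sum>\<^sub>\<infinity>y. a y * b (y + t)"]
      summable_on_SigmaD1[OF has_sum_imp_summable[OF s]]
    by (simp add: has_sum_infsum)
  then show "((\<lambda>t. conv (G t) (fcheck (F t)) x) has_sum
          (conv g (fcheck f) x * conv g' (fcheck f') x)) UNIV"
    by (simp add: a_def[abs_def] b_def[abs_def] F_def G_def conv_fcheck mult_ac add.assoc)
qed

text \<open>Two near-optimal representations are multiplied term by term and each product is
  expanded over the offset t. The result is a representation indexed by triples ((i, j), t), a
  countable type because G is countable; its cost is at most the product of the two costs.\<close>

lemma
  fixes u v :: "'g::{group_add,countable} \<Rightarrow> complex"
  assumes "u \<in> Ap p" "v \<in> Ap p"
  shows Ap_mult: "(\<lambda>x. u x * v x) \<in> Ap p"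
    and Apnorm_mult: "Apnorm p (\<lambda>x. u x * v x) \<le> Apnorm p u * Apnorm p v"
proof -
  have *: "(\<lambda>x. u x * v x) \<in> Ap p \<and> Apnorm p (\<lambda>x. u x * v x) \<le> (Apnorm p u + e) * (Apnorm p v + e)"
    if e0: "0 < e" for e
  proof -
    obtain f g s where r: "\<And>i::nat. lp p (f i)" "\<And>i. lp (conj_exp p) (g i)"
      "((\<lambda>i. lpnorm p (f i) * lpnorm (conj_exp p) (g i)) has_sum s) UNIV" "s < Apnorm p u + e"
      "\<And>x. ((\<lambda>i. conv (g i) (fcheck (f i)) x) has_sum u x) UNIV" by (rule Ap_repE[OF assms(1) e0]) (rule that)
    obtain f' g' s' where r': "\<And>i::nat. lp p (f' i)" "\<And>i. lp (conj_exp p) (g' i)"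
      "((\<lambda>i. lpnorm p (f' i) * lpnorm (conj_exp p) (g' i)) has_sum s') UNIV" "s' < Apnorm p v + e"
      "\<And>x. ((\<lambda>i. conv (g' i) (fcheck (f' i)) x) has_sum v x) UNIV" by (rule Ap_repE[OF assms(2) e0]) (rule that)
    define F where "F = (\<lambda>((i, j), t) y. f i y * f' j (y + t))"
    define G where "G = (\<lambda>((i, j), t) y. g i y * g' j (y + t))"
    define N where "N k = lpnorm p (F k) * lpnorm (conj_exp p) (G k)" for k
    define M where "M = (\<lambda>(i, j). (lpnorm p (f i) * lpnorm (conj_exp p) (g i)) *
          (lpnorm p (f' j) * lpnorm (conj_exp p) (g' j)))"
    have lpF: "lp p (F k)" "lp (conj_exp p) (G k)" for k
      by (auto simp: F_def G_def intro!: lp_twisted_product r(1,2) r'(1,2) split: prod.split)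
    have M: "(M has_sum s * s') (UNIV \<times> UNIV)"
      unfolding M_def infsumI[OF r(3), symmetric] infsumI[OF r'(3), symmetric]
      by (rule has_sum_product) (use has_sum_imp_summable[OF r(3)] has_sum_imp_summable[OF r'(3)] in auto)
    have Nt: "(\<lambda>t. N (k, t)) summable_on UNIV" "(\<Sum>\<^sub>\<infinity>t. N (k, t)) \<le> M k" for k
      unfolding N_def F_def G_def M_def
      using summable_twisted_product[OF r(1) r'(1) r(2) r'(2)] infsum_twisted_product[OF r(1) r'(1) r(2) r'(2)]
      by (auto split: prod.split)
    have N0: "0 \<le> N k" for k by (simp add: N_def)
    have Ns: "(\<lambda>k. \<Sum>\<^sub>\<infinity>t. N (k, t)) summable_on UNIV \<times> UNIV"
      by (rule summable_on_comparison_test[OF has_sum_imp_summable[OF M]])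
         (use Nt in \<open>auto intro!: infsum_nonneg N0\<close>)
    have Nsum: "N summable_on (UNIV \<times> UNIV) \<times> UNIV"
      by (rule summable_on_SigmaI[OF _ Ns]) (use Nt N0 in auto)
    have "infsum N UNIV = (\<Sum>\<^sub>\<infinity>k\<in>UNIV \<times> UNIV. \<Sum>\<^sub>\<infinity>t. N (k, t))"
      using infsum_Sigma_banach[OF Nsum] by simp
    also have "\<dots> \<le> s * s'"
      using infsum_mono[OF Ns has_sum_imp_summable[OF M]] Nt infsumI[OF M] by simp
    also have "\<dots> \<le> (Apnorm p u + e) * (Apnorm p v + e)"
      using r(4) r'(4) Apnorm_nonneg[OF assms(1)] e0
        has_sum_nonneg[OF r(3)] has_sum_nonneg[OF r'(3)]
      by (intro mult_mono) auto
    finally have le: "infsum N UNIV \<le> (Apnorm p u + e) * (Apnorm p v + e)" .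
    have 2: "((\<lambda>k. lpnorm p (F k) * lpnorm (conj_exp p) (G k)) has_sum infsum N UNIV) UNIV"
      using Nsum unfolding N_def[abs_def] by (simp add: has_sum_infsum)
    have 3: "((\<lambda>k. conv (G k) (fcheck (F k)) x) has_sum (u x * v x)) UNIV" for x
    proof -
      let ?U = "\<lambda>i. conv (g i) (fcheck (f i)) x" and ?V = "\<lambda>j. conv (g' j) (fcheck (f' j)) x"
      have "(\<lambda>k. norm (conv (G k) (fcheck (F k)) x)) summable_on (UNIV \<times> UNIV) \<times> UNIV"
        by (rule Infinite_Sum.abs_summable_on_comparison_test'[OF Nsum]) (auto simp: N_def intro!: norm_conv_le lpF)
      then have sm: "(\<lambda>k. conv (G k) (fcheck (F k)) x) summable_on (UNIV \<times> UNIV) \<times> UNIV"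
        by (rule abs_summable_summable)
      have "(\<lambda>i. norm (?U i)) summable_on UNIV" "(\<lambda>j. norm (?V j)) summable_on UNIV"
        by (rule Infinite_Sum.abs_summable_on_comparison_test'[OF has_sum_imp_summable[OF r(3)]],
            rule norm_conv_le[OF r(1,2)],
            rule Infinite_Sum.abs_summable_on_comparison_test'[OF has_sum_imp_summable[OF r'(3)]],
            rule norm_conv_le[OF r'(1,2)])
      from has_sum_product[OF this]
      have uv: "((\<lambda>(i, j). ?U i * ?V j) has_sum (u x * v x)) (UNIV \<times> UNIV)"
        using infsumI[OF r(5)] infsumI[OF r'(5)] by simp
      have "((\<lambda>k. conv (G k) (fcheck (F k)) x) has_sum (u x * v x)) ((UNIV \<times> UNIV) \<times> UNIV)"
        by (rule has_sum_SigmaI[OF _ uv sm])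
           (auto simp: F_def G_def intro!: conv_twisted_product r(1,2) r'(1,2))
      then show ?thesis by simp
    qed
    show ?thesis using Ap_countable_repI[OF lpF 2 3] le by auto
  qed
  show "(\<lambda>x. u x * v x) \<in> Ap p" using *[of 1] by simp
  \<comment> \<open>The slack enters both factors of the bound, so it is removed by letting
    \<open>e\<close> tend to 0 from the right.\<close>
  have "eventually (\<lambda>e. Apnorm p (\<lambda>x. u x * v x) \<le> (Apnorm p u + e) * (Apnorm p v + e)) (at_right 0)"
    using eventually_at_right_less[of "0::real"] by eventually_elim (use * in blast)
  moreover have "((\<lambda>e. (Apnorm p u + e) * (Apnorm p v + e)) \<longlongrightarrow> (Apnorm p u + 0) * (Apnorm p v + 0)) (at_right 0)"
    by (intro tendsto_intros)
  ultimately show "Apnorm p (\<lambda>x. u x * v x) \<le> Apnorm p u * Apnorm p v"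
    using tendsto_lowerbound[of _ _ "at_right (0::real)"] by fastforce
qed

end

section \<open>Dual, bidual and Arens products\<close>

context
  fixes p :: real
  assumes p1: "1 < p"
begin

lemma Ap_diff:
  fixes u v :: "'g::group_add \<Rightarrow> complex"
  assumes "u \<in> Ap p" "v \<in> Ap p"
  shows "(\<lambda>x. u x - v x) \<in> Ap p"
  using Ap_add[OF p1 assms(1) Ap_cmult[OF p1 assms(2), of "-1"]] by simp

lemma Ap_ballD: "u \<in> Ap_ball p \<Longrightarrow> u \<in> Ap p" "u \<in> Ap_ball p \<Longrightarrow> Apnorm p u \<le> 1"
  by (auto simp: Ap_ball_def)

lemma zero_in_Ap_ball: "(\<lambda>_::'g::group_add. 0) \<in> Ap_ball p"
  by (simp add: Ap_ball_def Ap_zero[OF p1] Apnorm_zero[OF p1])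

lemma Ap_ball_mult:
  fixes u v :: "'g::{group_add,countable} \<Rightarrow> complex"
  assumes "u \<in> Ap_ball p" "v \<in> Ap_ball p"
  shows "(\<lambda>x. u x * v x) \<in> Ap_ball p"
proof -
  note m = Ap_ballD[OF assms(1)] Ap_ballD[OF assms(2)]
  have "Apnorm p u * Apnorm p v \<le> 1"
    using m Apnorm_nonneg[OF p1 m(1)] Apnorm_nonneg[OF p1 m(3)] by (intro mult_le_one) auto
  then show ?thesis
    using Ap_mult[OF p1 m(1,3)] Apnorm_mult[OF p1 m(1,3)] by (simp add: Ap_ball_def)
qed

lemma Ap_ball_convex:
  fixes u v :: "'g::group_add \<Rightarrow> complex"
  assumes "u \<in> Ap_ball p" "v \<in> Ap_ball p" "0 \<le> t" "t \<le> 1"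
  shows "(\<lambda>x. complex_of_real (1 - t) * u x + complex_of_real t * v x) \<in> Ap_ball p"
proof -
  note m = Ap_ballD[OF assms(1)] Ap_ballD[OF assms(2)]
  have *: "(\<lambda>x. complex_of_real r * h x) \<in> Ap p" "Apnorm p (\<lambda>x. complex_of_real r * h x) \<le> r"
    if "h \<in> Ap_ball p" "0 \<le> r" for h :: "'g \<Rightarrow> complex" and r
  proof -
    note h = Ap_ballD[OF that(1)]
    show "(\<lambda>x. complex_of_real r * h x) \<in> Ap p" by (rule Ap_cmult[OF p1 h(1)])
    have "Apnorm p (\<lambda>x. complex_of_real r * h x) \<le> norm (complex_of_real r) * Apnorm p h"
      by (rule Apnorm_cmult_le[OF p1 h(1)])
    also have "\<dots> \<le> r" using that h by (simp add: mult_left_le)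
    finally show "Apnorm p (\<lambda>x. complex_of_real r * h x) \<le> r" .
  qed
  have t: "0 \<le> 1 - t" using assms by simp
  note a = *[OF assms(1) t] and b = *[OF assms(2,3)]
  show ?thesis
    using Ap_add[OF p1 a(1) b(1)] Apnorm_add[OF p1 a(1) b(1)] a(2) b(2) by (simp add: Ap_ball_def)
qed

lemma Ap_ball_cmult:
  fixes u :: "'g::group_add \<Rightarrow> complex"
  assumes "u \<in> Ap_ball p" "norm c \<le> 1"
  shows "(\<lambda>x. c * u x) \<in> Ap_ball p"
proof -
  note m = Ap_ballD[OF assms(1)]
  have "norm c * Apnorm p u \<le> 1"
    using m Apnorm_nonneg[OF p1 m(1)] assms(2) by (intro mult_le_one) auto
  then show ?thesis using Ap_cmult[OF p1 m(1)] Apnorm_cmult_le[OF p1 m(1), of c]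
    by (simp add: Ap_ball_def)
qed

lemma Ap_dualD:
  assumes "T \<in> Ap_dual p"
  shows "u \<in> Ap p \<Longrightarrow> v \<in> Ap p \<Longrightarrow> T (\<lambda>x. u x + v x) = T u + T v"
    and "u \<in> Ap p \<Longrightarrow> T (\<lambda>x. c * u x) = c * T u"
    and "u \<notin> Ap p \<Longrightarrow> T u = 0"
  using assms by (auto simp: Ap_dual_def)

lemma Ap_dualI:
  assumes "\<And>u v. u \<in> Ap p \<Longrightarrow> v \<in> Ap p \<Longrightarrow> T (\<lambda>x. u x + v x) = T u + T v"
    and "\<And>c u. u \<in> Ap p \<Longrightarrow> T (\<lambda>x. c * u x) = c * T u"
    and "\<And>u. u \<in> Ap p \<Longrightarrow> norm (T u) \<le> C * Apnorm p u"
    and "\<And>u. u \<notin> Ap p \<Longrightarrow> T u = 0"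
  shows "T \<in> Ap_dual p"
  using assms unfolding Ap_dual_def by blast

lemma Ap_dual_zero: "T \<in> Ap_dual p \<Longrightarrow> T (\<lambda>_::'g::group_add. 0) = 0"
  using Ap_dualD(2)[of T "\<lambda>_. 0" 0] Ap_zero[OF p1] by simp

lemma Ap_dual_diff:
  fixes u v :: "'g::group_add \<Rightarrow> complex"
  assumes "T \<in> Ap_dual p" "u \<in> Ap p" "v \<in> Ap p"
  shows "T (\<lambda>x. u x - v x) = T u - T v"
  using Ap_dualD(1)[OF assms(1,2) Ap_cmult[OF p1 assms(3), of "-1"]] Ap_dualD(2)[OF assms(1,3), of "-1"]
  by simp

lemma dual_norm_upper:
  fixes T :: "('g::group_add \<Rightarrow> complex) \<Rightarrow> complex"
  assumes "T \<in> Ap_dual p" "u \<in> Ap_ball p"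
  shows "norm (T u) \<le> dual_norm p T"
proof -
  obtain C where C: "\<forall>u\<in>Ap p. norm (T u) \<le> C * Apnorm p u" using assms by (auto simp: Ap_dual_def)
  have "norm (T v) \<le> \<bar>C\<bar>" if "v \<in> Ap_ball p" for v
  proof -
    have "norm (T v) \<le> C * Apnorm p v" using C Ap_ballD(1)[OF that] by blast
    also have "\<dots> \<le> \<bar>C\<bar> * Apnorm p v"
      by (rule mult_right_mono) (use Apnorm_nonneg[OF p1 Ap_ballD(1)[OF that]] in auto)
    also have "\<dots> \<le> \<bar>C\<bar>" by (rule mult_left_le) (use Ap_ballD(2)[OF that] in auto)
    finally show ?thesis .
  qed
  then have "bdd_above {norm (T u) |u. u \<in> Ap_ball p}" by (intro bdd_aboveI) auto
  then show ?thesis unfolding dual_norm_def using assms by (intro cSup_upper) auto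
qed

lemma dual_norm_nonneg: "T \<in> Ap_dual p \<Longrightarrow> 0 \<le> dual_norm p (T :: ('g::group_add \<Rightarrow> complex) \<Rightarrow> complex)"
  using dual_norm_upper[OF _ zero_in_Ap_ball] norm_ge_zero order_trans by blast

lemma dual_norm_leI:
  fixes T :: "('g::group_add \<Rightarrow> complex) \<Rightarrow> complex"
  assumes "\<And>u. u \<in> Ap_ball p \<Longrightarrow> norm (T u) \<le> C"
  shows "dual_norm p T \<le> C"
  unfolding dual_norm_def using assms zero_in_Ap_ball by (intro cSup_least) auto

lemma dual_norm_bound:
  fixes T :: "('g::group_add \<Rightarrow> complex) \<Rightarrow> complex"
  assumes "T \<in> Ap_dual p" "u \<in> Ap p"
  shows "norm (T u) \<le> dual_norm p T * Apnorm p u"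
proof (cases "Apnorm p u = 0")
  case True
  \<comment> \<open>Here \<open>u\<close> cannot be normalised, but boundedness of \<open>T\<close>
    by any constant already forces \<open>T u = 0\<close>.\<close>
  obtain C where "\<forall>u\<in>Ap p. norm (T u) \<le> C * Apnorm p u" using assms by (auto simp: Ap_dual_def)
  then show ?thesis using assms True by fastforce
next
  case False
  let ?N = "Apnorm p u"
  have pos: "?N > 0" using False Apnorm_nonneg[OF p1 assms(2)] by simp
  let ?v = "\<lambda>x. complex_of_real (inverse ?N) * u x"
  have "?v \<in> Ap_ball p"
    using Ap_cmult[OF p1 assms(2)] Apnorm_cmult_le[OF p1 assms(2), of "complex_of_real (inverse ?N)"] pos
    by (simp add: Ap_ball_def norm_inverse)
  from dual_norm_upper[OF assms(1) this] have "inverse ?N * norm (T u) \<le> dual_norm p T"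
    unfolding Ap_dualD(2)[OF assms] using pos by (simp add: norm_mult norm_inverse)
  then show ?thesis using pos by (simp add: field_simps)
qed

text \<open>Pointwise multiplication is commutative, so the left and right module actions merge.
  Arens regularity then says that \<open>F\<close> at \<open>bidual_act_l p G T\<close> equals
  \<open>G\<close> at \<open>bidual_act_l p F T\<close>.\<close>

lemma dual_act_l_eq: "dual_act_l p a T = dual_act_r p T a"
  by (simp add: fun_eq_iff dual_act_l_def dual_act_r_def mult.commute)

lemma bidual_act_r_eq: "bidual_act_r p T F = bidual_act_l p F T"
  by (simp add: fun_eq_iff bidual_act_l_def bidual_act_r_def dual_act_l_eq)

lemma
  fixes T :: "('g::{group_add,countable} \<Rightarrow> complex) \<Rightarrow> complex"
  assumes T: "T \<in> Ap_dual p" and a: "a \<in> Ap p"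
  shows dual_act_r_dual: "dual_act_r p T a \<in> Ap_dual p"
    and dual_norm_act_r: "dual_norm p (dual_act_r p T a) \<le> dual_norm p T * Apnorm p a"
proof -
  have le: "norm (dual_act_r p T a u) \<le> dual_norm p T * Apnorm p a * Apnorm p u" if u: "u \<in> Ap p" for u
  proof -
    have "norm (dual_act_r p T a u) \<le> dual_norm p T * Apnorm p (\<lambda>x. a x * u x)"
      using dual_norm_bound[OF T Ap_mult[OF p1 a u]] u by (simp add: dual_act_r_def)
    also have "\<dots> \<le> dual_norm p T * (Apnorm p a * Apnorm p u)"
      by (intro mult_left_mono Apnorm_mult[OF p1 a u] dual_norm_nonneg T)
    finally show ?thesis by (simp add: mult.assoc)
  qed
  show "dual_act_r p T a \<in> Ap_dual p"
  proof (rule Ap_dualI[OF _ _ le])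
    fix u v :: "'g \<Rightarrow> complex" and c
    assume u: "u \<in> Ap p"
    show "dual_act_r p T a (\<lambda>x. c * u x) = c * dual_act_r p T a u"
      using Ap_dualD(2)[OF T Ap_mult[OF p1 a u], of c] u Ap_cmult[OF p1 u]
      by (simp add: dual_act_r_def mult.left_commute)
    assume v: "v \<in> Ap p"
    show "dual_act_r p T a (\<lambda>x. u x + v x) = dual_act_r p T a u + dual_act_r p T a v"
      using Ap_dualD(1)[OF T Ap_mult[OF p1 a u] Ap_mult[OF p1 a v]] u v Ap_add[OF p1 u v]
      by (simp add: dual_act_r_def distrib_left)
  qed (simp_all add: dual_act_r_def)
  show "dual_norm p (dual_act_r p T a) \<le> dual_norm p T * Apnorm p a"
  proof (rule dual_norm_leI)
    fix u :: "'g \<Rightarrow> complex" assume u: "u \<in> Ap_ball p"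
    have "norm (dual_act_r p T a u) \<le> dual_norm p T * Apnorm p a * Apnorm p u"
      using le Ap_ballD[OF u] by blast
    also have "\<dots> \<le> dual_norm p T * Apnorm p a"
      by (rule mult_left_le) (use Ap_ballD[OF u] dual_norm_nonneg[OF T] Apnorm_nonneg[OF p1 a] in auto)
    finally show "norm (dual_act_r p T a u) \<le> dual_norm p T * Apnorm p a" .
  qed
qed

lemma Ap_bidualD:
  assumes "F \<in> Ap_bidual p"
  shows "S \<in> Ap_dual p \<Longrightarrow> T \<in> Ap_dual p \<Longrightarrow> F (\<lambda>u. S u + T u) = F S + F T"
    and "T \<in> Ap_dual p \<Longrightarrow> F (\<lambda>u. c * T u) = c * F T"
  using assms by (auto simp: Ap_bidual_def)

lemma Ap_bidual_bound:
  fixes F :: "(('g::group_add \<Rightarrow> complex) \<Rightarrow> complex) \<Rightarrow> complex"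
  assumes "F \<in> Ap_bidual p"
  obtains C where "C > 0" "\<And>T. T \<in> Ap_dual p \<Longrightarrow> norm (F T) \<le> C * dual_norm p T"
proof -
  obtain C where C: "\<forall>T\<in>Ap_dual p. norm (F T) \<le> C * dual_norm p T"
    using assms by (auto simp: Ap_bidual_def)
  have "norm (F T) \<le> (\<bar>C\<bar> + 1) * dual_norm p T" if "T \<in> Ap_dual p" for T
  proof -
    have "norm (F T) \<le> C * dual_norm p T" using C that by blast
    also have "\<dots> \<le> (\<bar>C\<bar> + 1) * dual_norm p T"
      by (rule mult_right_mono) (use dual_norm_nonneg[OF that] in auto)
    finally show ?thesis .
  qed
  then show thesis using that[of "\<bar>C\<bar> + 1"] by auto
qed

lemma bidual_act_l_dual:
  fixes T :: "('g::{group_add,countable} \<Rightarrow> complex) \<Rightarrow> complex"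
  assumes F: "F \<in> Ap_bidual p" and T: "T \<in> Ap_dual p"
  shows "bidual_act_l p F T \<in> Ap_dual p"
proof -
  obtain C where C: "C > 0" "\<And>T. T \<in> Ap_dual p \<Longrightarrow> norm (F T) \<le> C * dual_norm p T"
    by (rule Ap_bidual_bound[OF F]) (rule that)
  show ?thesis
  proof (rule Ap_dualI[where C = "C * dual_norm p T"])
    fix u v :: "'g \<Rightarrow> complex" and c
    assume u: "u \<in> Ap p"
    have "dual_act_r p T (\<lambda>x. c * u x) = (\<lambda>b. c * dual_act_r p T u b)"
      using Ap_dualD(2)[OF T Ap_mult[OF p1 u]] by (auto simp: dual_act_r_def fun_eq_iff mult.assoc)
    then show "bidual_act_l p F T (\<lambda>x. c * u x) = c * bidual_act_l p F T u"
      using Ap_bidualD(2)[OF F dual_act_r_dual[OF T u]] u Ap_cmult[OF p1 u] by (simp add: bidual_act_l_def)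
    have "norm (F (dual_act_r p T u)) \<le> C * dual_norm p (dual_act_r p T u)"
      by (rule C(2)[OF dual_act_r_dual[OF T u]])
    also have "\<dots> \<le> C * (dual_norm p T * Apnorm p u)"
      by (rule mult_left_mono[OF dual_norm_act_r[OF T u]]) (use C in auto)
    finally show "norm (bidual_act_l p F T u) \<le> C * dual_norm p T * Apnorm p u"
      using u by (simp add: bidual_act_l_def mult.assoc)
    assume v: "v \<in> Ap p"
    have "dual_act_r p T (\<lambda>x. u x + v x) = (\<lambda>b. dual_act_r p T u b + dual_act_r p T v b)"
      using Ap_dualD(1)[OF T Ap_mult[OF p1 u] Ap_mult[OF p1 v]]
      by (auto simp: dual_act_r_def fun_eq_iff distrib_right)
    then show "bidual_act_l p F T (\<lambda>x. u x + v x) = bidual_act_l p F T u + bidual_act_l p F T v"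
      using Ap_bidualD(1)[OF F dual_act_r_dual[OF T u] dual_act_r_dual[OF T v]] u v Ap_add[OF p1 u v]
      by (simp add: bidual_act_l_def)
  qed (simp add: bidual_act_l_def)
qed

section \<open>Bidual elements from sequences in the unit ball\<close>

definition ulim_functional :: "(nat \<Rightarrow> 'g::group_add \<Rightarrow> complex) \<Rightarrow> (('g \<Rightarrow> complex) \<Rightarrow> complex) \<Rightarrow> complex" where
  "ulim_functional f T = (if T \<in> Ap_dual p then ulim (\<lambda>n. T (f n)) else 0)"

lemma Ap_dual_add:
  fixes S T :: "('g::group_add \<Rightarrow> complex) \<Rightarrow> complex"
  assumes "S \<in> Ap_dual p" "T \<in> Ap_dual p"
  shows "(\<lambda>u. S u + T u) \<in> Ap_dual p"
proof (rule Ap_dualI[where C = "dual_norm p S + dual_norm p T"])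
  fix u :: "'g \<Rightarrow> complex" assume u: "u \<in> Ap p"
  show "norm (S u + T u) \<le> (dual_norm p S + dual_norm p T) * Apnorm p u"
    using norm_triangle_ineq[of "S u" "T u"] dual_norm_bound[OF assms(1) u] dual_norm_bound[OF assms(2) u]
    by (simp add: distrib_right)
qed (simp_all add: Ap_dualD[OF assms(1)] Ap_dualD[OF assms(2)] algebra_simps)

lemma Ap_dual_cmult:
  fixes T :: "('g::group_add \<Rightarrow> complex) \<Rightarrow> complex"
  assumes "T \<in> Ap_dual p"
  shows "(\<lambda>u. c * T u) \<in> Ap_dual p"
proof (rule Ap_dualI[where C = "norm c * dual_norm p T"])
  fix u :: "'g \<Rightarrow> complex" assume u: "u \<in> Ap p"
  show "norm (c * T u) \<le> norm c * dual_norm p T * Apnorm p u"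
    using mult_left_mono[OF dual_norm_bound[OF assms(1) u], of "norm c"] by (simp add: norm_mult mult.assoc)
qed (simp_all add: Ap_dualD[OF assms] algebra_simps)

lemma ulim_add:
  fixes a b :: "nat \<Rightarrow> complex"
  assumes "\<And>n. norm (a n) \<le> C" "\<And>n. norm (b n) \<le> D"
  shows "ulim (\<lambda>n. a n + b n) = ulim a + ulim b"
  by (intro ulim_eqI tendsto_add bounded_tendsto_ulim[OF assms(1)] bounded_tendsto_ulim[OF assms(2)])

lemma ulim_cmult:
  fixes a :: "nat \<Rightarrow> complex"
  assumes "\<And>n. norm (a n) \<le> C"
  shows "ulim (\<lambda>n. c * a n) = c * ulim a"
  by (intro ulim_eqI tendsto_mult_left bounded_tendsto_ulim[OF assms(1)])

lemma ulim_functional_bidual: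
  fixes f :: "nat \<Rightarrow> 'g::group_add \<Rightarrow> complex"
  assumes f: "\<And>n. f n \<in> Ap_ball p"
  shows "ulim_functional f \<in> Ap_bidual p"
proof -
  have b: "norm (T (f n)) \<le> dual_norm p T" if "T \<in> Ap_dual p" for T n
    by (rule dual_norm_upper[OF that f])
  have "norm (ulim_functional f T) \<le> 1 * dual_norm p T" if "T \<in> Ap_dual p" for T
    using norm_ulim_le[OF b[OF that]] that by (simp add: ulim_functional_def)
  moreover have "ulim (\<lambda>n. S (f n) + T (f n)) = ulim (\<lambda>n. S (f n)) + ulim (\<lambda>n. T (f n))"
    if "S \<in> Ap_dual p" "T \<in> Ap_dual p" for S T by (rule ulim_add[OF b[OF that(1)] b[OF that(2)]])
  moreover have "ulim (\<lambda>n. c * T (f n)) = c * ulim (\<lambda>n. T (f n))" if "T \<in> Ap_dual p" for c T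
    by (rule ulim_cmult[OF b[OF that]])
  ultimately show ?thesis unfolding Ap_bidual_def
    by (auto simp: ulim_functional_def Ap_dual_add Ap_dual_cmult intro!: exI[of _ 1])
qed

text \<open>On functionals that are ultrafilter limits of evaluations each Arens product unfolds to
  an iterated limit: the first product applies G first, so the limit over m is innermost, and the
  second applies F first.\<close>

lemma arens_regular_imp_ulim_swap:
  fixes f g :: "nat \<Rightarrow> 'g::{group_add,countable} \<Rightarrow> complex"
  assumes reg: "Ap_arens_regular TYPE('g) p" and f: "\<And>n. f n \<in> Ap_ball p" and g: "\<And>n. g n \<in> Ap_ball p"
    and T: "T \<in> Ap_dual p"
  shows "ulim (\<lambda>n. ulim (\<lambda>m. T (\<lambda>x. f n x * g m x))) = ulim (\<lambda>m. ulim (\<lambda>n. T (\<lambda>x. f n x * g m x)))"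
proof -
  let ?F = "ulim_functional f" and ?G = "ulim_functional g"
  have FG: "?F \<in> Ap_bidual p" "?G \<in> Ap_bidual p" using ulim_functional_bidual f g by auto
  have "arens1 p ?F ?G T = arens2 p ?F ?G T"
    using reg FG by (simp add: Ap_arens_regular_def)
  moreover have "arens1 p ?F ?G T = ulim (\<lambda>n. ulim (\<lambda>m. T (\<lambda>x. f n x * g m x)))"
    using T bidual_act_l_dual[OF FG(2) T] dual_act_r_dual[OF T] Ap_ballD(1)[OF f] Ap_ballD(1)[OF g]
    by (simp add: arens1_def ulim_functional_def bidual_act_l_def dual_act_r_def)
  moreover have "arens2 p ?F ?G T = ulim (\<lambda>m. ulim (\<lambda>n. T (\<lambda>x. f n x * g m x)))"
    using T bidual_act_l_dual[OF FG(1) T] dual_act_r_dual[OF T] Ap_ballD(1)[OF f] Ap_ballD(1)[OF g]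
    by (simp add: arens2_def bidual_act_r_eq ulim_functional_def bidual_act_l_def dual_act_r_def mult.commute)
  ultimately show ?thesis by simp
qed

text \<open>This takes the place of weak* compactness of the dual ball: on each \<open>u\<close> the
  values are bounded by \<open>Apnorm p u\<close>, so the pointwise ultrafilter limit exists and
  inherits linearity and the bound.\<close>

lemma Yp_cluster:
  fixes \<phi> :: "nat \<Rightarrow> ('g::group_add \<Rightarrow> complex) \<Rightarrow> complex"
  assumes \<phi>: "\<And>k. \<phi> k \<in> Yp p"
  shows "(\<lambda>u. ulim (\<lambda>k. \<phi> k u)) \<in> Ap_dual p"
proof -
  have d: "\<phi> k \<in> Ap_dual p" and d1: "dual_norm p (\<phi> k) \<le> 1" for k using \<phi> by (auto simp: Yp_def)
  have b: "norm (\<phi> k u) \<le> Apnorm p u" if "u \<in> Ap p" for k u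
    using dual_norm_bound[OF d that, of k] mult_right_mono[OF d1 Apnorm_nonneg[OF p1 that], of k] by simp
  show ?thesis
    by (rule Ap_dualI[where C = 1])
       (auto simp: Ap_dualD[OF d] ulim_add[OF b b] ulim_cmult[OF b] norm_ulim_le[OF b] ulim_LIMSEQ)
qed

section \<open>Helly approximation and the double limit criterion\<close>

lemma Ap_dual_sum:
  fixes \<T> :: "(('g::group_add \<Rightarrow> complex) \<Rightarrow> complex) set"
  assumes "finite \<T>" "\<T> \<subseteq> Ap_dual p"
  shows "(\<lambda>u. \<Sum>T\<in>\<T>. c T * T u) \<in> Ap_dual p"
  using assms
proof (induction \<T>)
  case empty
  show ?case by (rule Ap_dualI[where C = 0]) auto
next
  case (insert T \<T>)
  then show ?case using Ap_dual_add[OF Ap_dual_cmult[of T "c T"], of "\<lambda>u. \<Sum>T\<in>\<T>. c T * T u"] by simp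
qed

lemma Ap_bidual_sum:
  fixes \<T> :: "(('g::group_add \<Rightarrow> complex) \<Rightarrow> complex) set"
  assumes "finite \<T>" "\<T> \<subseteq> Ap_dual p" and F: "F \<in> Ap_bidual p"
  shows "F (\<lambda>u. \<Sum>T\<in>\<T>. c T * T u) = (\<Sum>T\<in>\<T>. c T * F T)"
  using assms(1,2)
proof (induction \<T>)
  case empty
  have "(\<lambda>_. 0) \<in> Ap_dual p" by (rule Ap_dualI[where C = 0]) auto
  from Ap_bidualD(2)[OF F this, of 0] show ?case by simp
next
  case (insert T \<T>)
  then show ?case
    using Ap_bidualD(1)[OF F Ap_dual_cmult[of T "c T"] Ap_dual_sum[of \<T> c]] Ap_bidualD(2)[OF F, of T "c T"]
    by simp
qed

text \<open>Helly's lemma, in place of Goldstine's theorem. If no element of the ball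
  approximated \<open>F\<close> on \<open>\<T>\<close>, a separating vector would give a combination
  \<open>S\<close> of \<open>\<T>\<close> with \<open>C * \<parallel>S\<parallel> < Re (F S)\<close>.\<close>

lemma Ap_bidual_Helly_Re:
  fixes \<T> :: "(('g::group_add \<Rightarrow> complex) \<Rightarrow> complex) set"
  assumes F: "F \<in> Ap_bidual p" and "C > 0" and C: "\<And>T. T \<in> Ap_dual p \<Longrightarrow> norm (F T) \<le> C * dual_norm p T"
    and fin: "finite \<T>" and sub: "\<T> \<subseteq> Ap_dual p" and "e > 0"
  shows "\<exists>u\<in>Ap_ball p. \<forall>T\<in>\<T>. \<bar>C * Re (T u) - Re (F T)\<bar> < e"
proof (rule ccontr)
  assume far: "\<not> ?thesis"
  \<comment> \<open>Convexity is required of total functions on all \<open>T\<close>, including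
    those that are not linear; setting \<open>k u T\<close> to 0 off \<open>\<T>\<close> makes the
    image of the ball convex in that sense.\<close>
  define k where "k u T = (if T \<in> \<T> then C * Re (T u) else 0)" for u T
  have ne: "k ` Ap_ball p \<noteq> {}" using zero_in_Ap_ball by blast
  have away: "\<exists>i\<in>\<T>. e \<le> \<bar>c i - Re (F i)\<bar>" if "c \<in> k ` Ap_ball p" for c
    using far that by (fastforce simp: k_def not_less)
  have bnd: "\<bar>c T\<bar> \<le> C * (\<Sum>T\<in>\<T>. dual_norm p T)" if cT: "c \<in> k ` Ap_ball p" "T \<in> \<T>" for c T
  proof -
    obtain u where u: "u \<in> Ap_ball p" "c = k u" using cT(1) by blast
    have "\<bar>Re (T u)\<bar> \<le> dual_norm p T"
      using abs_Re_le_cmod[of "T u"] dual_norm_upper[of T u] u sub cT by fastforce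
    also have "\<dots> \<le> (\<Sum>T\<in>\<T>. dual_norm p T)"
      using cT sub fin by (intro member_le_sum) (auto intro: dual_norm_nonneg)
    finally show ?thesis using \<open>C > 0\<close> u cT by (simp add: abs_mult k_def)
  qed
  have cvx: "(\<lambda>i. (1 - t) * c i + t * c' i) \<in> k ` Ap_ball p"
    if c: "c \<in> k ` Ap_ball p" "c' \<in> k ` Ap_ball p" and t: "0 \<le> t" "t \<le> 1" for c c' t
  proof -
    obtain u v where u: "u \<in> Ap_ball p" "c = k u" and v: "v \<in> Ap_ball p" "c' = k v" using c by blast
    define y where "y = (\<lambda>x. complex_of_real (1 - t) * u x + complex_of_real t * v x)"
    have Ty: "T y = complex_of_real (1 - t) * T u + complex_of_real t * T v" if "T \<in> \<T>" for T
    proof -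
      have T: "T \<in> Ap_dual p" using sub that by blast
      show ?thesis unfolding y_def
          Ap_dualD(1)[OF T Ap_cmult[OF p1 Ap_ballD(1)[OF u(1)]] Ap_cmult[OF p1 Ap_ballD(1)[OF v(1)]]]
          Ap_dualD(2)[OF T Ap_ballD(1)[OF u(1)]] Ap_dualD(2)[OF T Ap_ballD(1)[OF v(1)]] ..
    qed
    have "k y = (\<lambda>T. (1 - t) * c T + t * c' T)"
    proof
      show "k y T = (1 - t) * c T + t * c' T" for T
        by (cases "T \<in> \<T>") (simp_all add: k_def u v Ty algebra_simps)
    qed
    moreover have "k y \<in> k ` Ap_ball p"
      unfolding y_def by (rule imageI[OF Ap_ball_convex[OF u(1) v(1) t]])
    ultimately show ?thesis by (simp only:)
  qed
  have "\<exists>w. \<exists>\<beta>>0. \<forall>c\<in>k ` Ap_ball p. (\<Sum>T\<in>\<T>. w T * c T) + \<beta> \<le> (\<Sum>T\<in>\<T>. w T * Re (F T))"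
    by (rule approx_separation[where I = \<T> and C = "k ` Ap_ball p" and e = e
          and B = "C * (\<Sum>T\<in>\<T>. dual_norm p T)" and z = "\<lambda>T. Re (F T)"])
       (fact fin ne cvx bnd away \<open>e > 0\<close>)+
  then obtain w \<beta> where "\<beta> > 0"
    and sep: "\<And>u. u \<in> Ap_ball p \<Longrightarrow> (\<Sum>T\<in>\<T>. w T * k u T) + \<beta> \<le> (\<Sum>T\<in>\<T>. w T * Re (F T))"
    by blast
  define S where "S u = (\<Sum>T\<in>\<T>. complex_of_real (w T) * T u)" for u
  have S: "S \<in> Ap_dual p" unfolding S_def[abs_def] by (rule Ap_dual_sum[OF fin sub])
  have FS: "Re (F S) = (\<Sum>T\<in>\<T>. w T * Re (F T))"
    unfolding S_def[abs_def] Ap_bidual_sum[OF fin sub F] by simp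
  have kS: "(\<Sum>T\<in>\<T>. w T * k u T) = C * Re (S u)" for u
    by (simp add: S_def k_def sum_distrib_left mult_ac)
  have "norm (S u) \<le> (Re (F S) - \<beta>) / C" if u: "u \<in> Ap_ball p" for u
  proof -
    \<comment> \<open>The ball is invariant under the scalar \<open>c\<close>, which rotates
      \<open>S u\<close> onto its modulus; the separation inequality for real parts thereby bounds
      the norm of \<open>S\<close>.\<close>
    define c where "c = (if S u = 0 then 1 else cnj (S u) / norm (S u))"
    have c: "norm c \<le> 1" by (simp add: c_def norm_divide)
    have "c * S u = norm (S u)"
      by (auto simp: c_def complex_norm_square[symmetric] power2_eq_square mult.commute[of "cnj (S u)"])
    then have "S (\<lambda>x. c * u x) = norm (S u)"
      using Ap_dualD(2)[OF S Ap_ballD(1)[OF u]] by simp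
    with sep[OF Ap_ball_cmult[OF u c]] show ?thesis
      unfolding kS FS[symmetric] using \<open>C > 0\<close> by (simp add: field_simps)
  qed
  then have "dual_norm p S \<le> (Re (F S) - \<beta>) / C" by (rule dual_norm_leI)
  then have "C * dual_norm p S < Re (F S)" using \<open>C > 0\<close> \<open>\<beta> > 0\<close> by (simp add: field_simps)
  also have "\<dots> \<le> C * dual_norm p S" using C[OF S] complex_Re_le_cmod[of "F S"] by simp
  finally show False by simp
qed

text \<open>The imaginary part of z is the real part of -iz, so the real version is applied to
  \<open>\<T>\<close> together with its multiples by -i, with tolerance e/2 for each part.\<close>

lemma Ap_bidual_Helly:
  fixes \<T> :: "(('g::group_add \<Rightarrow> complex) \<Rightarrow> complex) set"
  assumes F: "F \<in> Ap_bidual p" and "C > 0" and C: "\<And>T. T \<in> Ap_dual p \<Longrightarrow> norm (F T) \<le> C * dual_norm p T"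
    and fin: "finite \<T>" and sub: "\<T> \<subseteq> Ap_dual p" and "e > 0"
  shows "\<exists>u\<in>Ap_ball p. \<forall>T\<in>\<T>. norm (complex_of_real C * T u - F T) < e"
proof -
  define j where "j = - \<i>"
  let ?J = "(\<lambda>T u. j * T u) ` \<T>"
  have "\<exists>u\<in>Ap_ball p. \<forall>T\<in>\<T> \<union> ?J. \<bar>C * Re (T u) - Re (F T)\<bar> < e / 2"
    using fin sub \<open>e > 0\<close> by (intro Ap_bidual_Helly_Re[OF F \<open>C > 0\<close> C]) (auto intro: Ap_dual_cmult)
  then obtain u where u: "u \<in> Ap_ball p"
    and less: "\<forall>T\<in>\<T> \<union> ?J. \<bar>C * Re (T u) - Re (F T)\<bar> < e / 2" by (rule bexE)
  have "norm (complex_of_real C * T u - F T) < e" if T: "T \<in> \<T>" for T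
  proof -
    have "F (\<lambda>u. j * T u) = j * F T" by (rule Ap_bidualD(2)[OF F]) (use T sub in blast)
    then have "\<bar>C * Im (T u) - Im (F T)\<bar> < e / 2"
      using bspec[OF less, of "\<lambda>u. j * T u"] T by (simp add: j_def)
    moreover have "\<bar>C * Re (T u) - Re (F T)\<bar> < e / 2" using less T by blast
    ultimately show ?thesis using cmod_le[of "C * T u - F T"] by simp
  qed
  with u show ?thesis by blast
qed

text \<open>The values of the two Arens products at T, divided by the same constant CD, are realised
  as the two iterated limits of one double sequence T(f_n g_m); the hypothesis then equates them.
  The constants appear because elements of the unit ball can only approximate F/C and G/D.\<close>

lemma double_limit_imp_arens_regular:
  assumes DL: "\<And>(f :: nat \<Rightarrow> 'g::{group_add,countable} \<Rightarrow> complex) g T c d c' d'.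
      (\<And>n. f n \<in> Ap_ball p) \<Longrightarrow> (\<And>m. g m \<in> Ap_ball p) \<Longrightarrow> T \<in> Ap_dual p \<Longrightarrow>
      (\<And>n. (\<lambda>m. T (\<lambda>x. f n x * g m x)) \<longlonglongrightarrow> c n) \<Longrightarrow> c \<longlonglongrightarrow> d \<Longrightarrow>
      (\<And>m. (\<lambda>n. T (\<lambda>x. f n x * g m x)) \<longlonglongrightarrow> c' m) \<Longrightarrow> c' \<longlonglongrightarrow> d' \<Longrightarrow> d = d'"
  shows "Ap_arens_regular TYPE('g) p"
  unfolding Ap_arens_regular_def
proof (intro ballI)
  fix F G :: "(('g \<Rightarrow> complex) \<Rightarrow> complex) \<Rightarrow> complex"
  assume F: "F \<in> Ap_bidual p" and G: "G \<in> Ap_bidual p"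
  have "F (bidual_act_l p G T) = G (bidual_act_l p F T)" if T: "T \<in> Ap_dual p" for T
  proof -
    obtain C where C: "C > 0" "\<And>T. T \<in> Ap_dual p \<Longrightarrow> norm (F T) \<le> C * dual_norm p T"
      by (rule Ap_bidual_bound[OF F]) (rule that)
    obtain D where D: "D > 0" "\<And>T. T \<in> Ap_dual p \<Longrightarrow> norm (G T) \<le> D * dual_norm p T"
      by (rule Ap_bidual_bound[OF G]) (rule that)
    \<comment> \<open>Choosing approximants for all finite families and all tolerances at once
      leaves an explicit recursion for the sequences. The tolerance 1/(n+1) makes the approximations
      converge.\<close>
    have "\<exists>u. \<forall>\<T>\<in>{\<T>. finite \<T> \<and> \<T> \<subseteq> Ap_dual p}. \<forall>n::nat. u \<T> n \<in> Ap_ball p \<and>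
        (\<forall>T\<in>\<T>. norm (complex_of_real C * T (u \<T> n) - F T) < 1 / Suc n)"
    proof (intro bchoice ballI choice allI)
      fix \<T> :: "(('g \<Rightarrow> complex) \<Rightarrow> complex) set" and n :: nat
      assume "\<T> \<in> {\<T>. finite \<T> \<and> \<T> \<subseteq> Ap_dual p}"
      then show "\<exists>u. u \<in> Ap_ball p \<and> (\<forall>T\<in>\<T>. norm (complex_of_real C * T u - F T) < 1 / Suc n)"
        using Ap_bidual_Helly[OF F C, of \<T> "1 / Suc n"] by auto
    qed
    then obtain hF where hF: "\<And>\<T> n. finite \<T> \<Longrightarrow> \<T> \<subseteq> Ap_dual p \<Longrightarrow> hF \<T> n \<in> Ap_ball p"
      "\<And>\<T> n T. finite \<T> \<Longrightarrow> \<T> \<subseteq> Ap_dual p \<Longrightarrow> T \<in> \<T> \<Longrightarrow> norm (complex_of_real C * T (hF \<T> n) - F T) < 1 / Suc n"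
      by blast
    have "\<exists>u. \<forall>\<T>\<in>{\<T>. finite \<T> \<and> \<T> \<subseteq> Ap_dual p}. \<forall>n::nat. u \<T> n \<in> Ap_ball p \<and>
        (\<forall>T\<in>\<T>. norm (complex_of_real D * T (u \<T> n) - G T) < 1 / Suc n)"
    proof (intro bchoice ballI choice allI)
      fix \<T> :: "(('g \<Rightarrow> complex) \<Rightarrow> complex) set" and n :: nat
      assume "\<T> \<in> {\<T>. finite \<T> \<and> \<T> \<subseteq> Ap_dual p}"
      then show "\<exists>u. u \<in> Ap_ball p \<and> (\<forall>T\<in>\<T>. norm (complex_of_real D * T u - G T) < 1 / Suc n)"
        using Ap_bidual_Helly[OF G D, of \<T> "1 / Suc n"] by auto
    qed
    then obtain hG where hG: "\<And>\<T> n. finite \<T> \<Longrightarrow> \<T> \<subseteq> Ap_dual p \<Longrightarrow> hG \<T> n \<in> Ap_ball p"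
      "\<And>\<T> n T. finite \<T> \<Longrightarrow> \<T> \<subseteq> Ap_dual p \<Longrightarrow> T \<in> \<T> \<Longrightarrow> norm (complex_of_real D * T (hG \<T> n) - G T) < 1 / Suc n"
      by blast
    txt \<open>The sequences are chosen alternately: \<open>f n\<close> approximates \<open>F\<close> on the functionals
      coming from \<open>G\<close> and \<open>g 0, \<dots>, g (n - 1)\<close>, and \<open>g n\<close> approximates \<open>G\<close> on those
      coming from \<open>F\<close> and \<open>f 0, \<dots>, f n\<close>. The state \<open>st\<close> collects the values chosen so far.\<close>
    define act where "act = dual_act_r p T"
    define nf where "nf n st = hF (insert (bidual_act_l p G T) (act ` snd st)) n"
      for n and st :: "('g \<Rightarrow> complex) set \<times> ('g \<Rightarrow> complex) set"
    define ng where "ng n st = hG (insert (bidual_act_l p F T) (act ` insert (nf n st) (fst st))) n" for n st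
    define st where "st = rec_nat ({}, {}) (\<lambda>n s. (insert (nf n s) (fst s), insert (ng n s) (snd s)))"
    define f where "f n = nf n (st n)" for n
    define g where "g n = ng n (st n)" for n
    have st_Suc: "st (Suc n) = (insert (f n) (fst (st n)), insert (g n) (snd (st n)))" and st_0: "st 0 = ({}, {})" for n
      by (simp_all add: st_def f_def g_def)
    have st: "st n = (f ` {..<n}, g ` {..<n})" for n
      by (induction n) (simp_all add: st_0 st_Suc lessThan_Suc)
    have f_eq: "f n = hF (insert (bidual_act_l p G T) ((act \<circ> g) ` {..<n})) n" for n
      by (simp add: f_def[of n] nf_def st image_comp)
    have nf_st: "nf n (f ` {..<n}, g ` {..<n}) = f n" for n using f_def[of n] st[of n] by simp
    have g_eq: "g n = hG (insert (bidual_act_l p F T) ((act \<circ> f) ` {..n})) n" for n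
      by (simp add: g_def[of n] ng_def st nf_st image_comp lessThan_Suc_atMost[symmetric] lessThan_Suc)
    have actd: "act a \<in> Ap_dual p" if "a \<in> Ap_ball p" for a
      unfolding act_def by (rule dual_act_r_dual[OF T Ap_ballD(1)[OF that]])
    note GT = bidual_act_l_dual[OF G T] and FT = bidual_act_l_dual[OF F T]
    \<comment> \<open>The choice functions are controlled only on families inside
      \<open>Ap_dual p\<close>, and the family used at stage n consists of actions of earlier terms;
      so membership in the ball needs strong induction, with \<open>f n\<close> settled before
      \<open>g n\<close>.\<close>
    have ball: "f n \<in> Ap_ball p \<and> g n \<in> Ap_ball p" for n
    proof (induction n rule: less_induct)
      case (less n)
      have fb: "f n \<in> Ap_ball p"
        unfolding f_eq[of n] by (rule hF(1)) (use less GT actd in auto)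
      have "(act \<circ> f) ` {..n} \<subseteq> Ap_dual p"
        using less fb actd by (auto simp: le_less)
      then have "g n \<in> Ap_ball p"
        unfolding g_eq[of n] by (intro hG(1)) (use FT in auto)
      with fb show ?case ..
    qed
    have fb: "f n \<in> Ap_ball p" and gb: "g n \<in> Ap_ball p" for n using ball by auto
    have fA: "f n \<in> Ap p" and gA: "g n \<in> Ap p" for n using Ap_ballD fb gb by auto
    have f1: "norm (complex_of_real C * S (f n) - F S) < 1 / Suc n" if "S = bidual_act_l p G T \<or> (\<exists>m<n. S = act (g m))" for S n
      unfolding f_eq[of n] by (rule hF(2)) (use that GT actd gb in auto)
    have g1: "norm (complex_of_real D * S (g n) - G S) < 1 / Suc n" if "S = bidual_act_l p F T \<or> (\<exists>m\<le>n. S = act (f m))" for S n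
      unfolding g_eq[of n] by (rule hG(2)) (use that FT actd fb in auto)
    \<comment> \<open>Only a tail is required: \<open>f n\<close> is fitted to the action of
      \<open>g m\<close> for m < n, and \<open>g m\<close> to the action of \<open>f n\<close> for n
      \<le> m.\<close>
    have lim: "a \<longlonglongrightarrow> l / K" if K: "K > 0" and ev: "\<And>n. n > N \<Longrightarrow> norm (complex_of_real K * a n - l) < 1 / Suc n"
      for a :: "nat \<Rightarrow> complex" and l K N
    proof -
      have "(\<lambda>n. complex_of_real K * a n - l) \<longlonglongrightarrow> 0"
        by (rule Lim_null_comparison[OF _ LIMSEQ_inverse_real_of_nat])
           (use eventually_gt_at_top[of N] in \<open>eventually_elim, use ev in \<open>force simp: divide_inverse\<close>\<close>)
      then have "(\<lambda>n. ((complex_of_real K * a n - l) + l) / K) \<longlonglongrightarrow> (0 + l) / K"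
        using K by (intro tendsto_intros) auto
      then show ?thesis using K by simp
    qed
    have act_eval: "act a b = T (\<lambda>x. a x * b x)" if "b \<in> Ap p" for a b
      using that by (simp add: act_def dual_act_r_def)
    have bid: "bidual_act_l p H T a = H (act a)" if "a \<in> Ap p" for H a
      using that by (simp add: bidual_act_l_def act_def)
    have "F (bidual_act_l p G T) / C / D = G (bidual_act_l p F T) / D / C"
    proof (rule DL[OF fb gb T])
      show "(\<lambda>m. T (\<lambda>x. f n x * g m x)) \<longlonglongrightarrow> bidual_act_l p G T (f n) / D" for n
      proof (rule lim[OF D(1), of n])
        fix m assume "n < m"
        then have "norm (complex_of_real D * act (f n) (g m) - G (act (f n))) < 1 / Suc m"
          by (intro g1 disjI2 exI[of _ n]) auto
        then show "norm (complex_of_real D * T (\<lambda>x. f n x * g m x) - bidual_act_l p G T (f n)) < 1 / Suc m"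
          by (simp add: act_eval[OF gA] bid[OF fA])
      qed
      show "(\<lambda>n. bidual_act_l p G T (f n) / D) \<longlonglongrightarrow> F (bidual_act_l p G T) / C / D"
        by (intro tendsto_divide lim[OF C(1), of 0] f1 tendsto_const) (use D in auto)
      show "(\<lambda>n. T (\<lambda>x. f n x * g m x)) \<longlonglongrightarrow> bidual_act_l p F T (g m) / C" for m
      proof (rule lim[OF C(1), of m])
        fix n assume "m < n"
        then have "norm (complex_of_real C * act (g m) (f n) - F (act (g m))) < 1 / Suc n"
          by (intro f1 disjI2 exI[of _ m]) auto
        then show "norm (complex_of_real C * T (\<lambda>x. f n x * g m x) - bidual_act_l p F T (g m)) < 1 / Suc n"
          by (simp add: act_eval[OF fA] bid[OF gA] mult.commute)
      qed
      show "(\<lambda>m. bidual_act_l p F T (g m) / C) \<longlonglongrightarrow> G (bidual_act_l p F T) / D / C"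
        by (intro tendsto_divide lim[OF D(1), of 0] g1 tendsto_const) (use C in auto)
    qed
    then show ?thesis using C(1) D(1) by (simp add: field_simps)
  qed
  then show "arens1 p F G = arens2 p F G"
    by (simp add: fun_eq_iff arens1_def arens2_def bidual_act_r_eq)
qed

end

section \<open>Density of finitely supported functions\<close>

lemma finite_to_nat_less: "finite {x::'g::countable. to_nat x < n}"
  by (rule inj_on_finite[of to_nat _ "{..<n}"]) (auto simp: inj_on_def)

lemma has_sum_remove_finite:
  fixes h :: "'i \<Rightarrow> 'b::real_normed_field"
  assumes "(h has_sum s) UNIV" "finite S"
  shows "((\<lambda>i. if i \<in> S then 0 else h i) has_sum (s - sum h S)) UNIV"
proof -
  have "((\<lambda>i. if i \<in> S then h i else 0) has_sum sum h S) UNIV"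
    by (rule has_sum_cong_neutral[THEN iffD1, OF _ _ _ has_sum_finite[OF assms(2)]]) auto
  from has_sum_add[OF assms(1) has_sum_uminusI[OF this]]
  have "((\<lambda>i. h i + - (if i \<in> S then h i else 0)) has_sum (s - sum h S)) UNIV" by simp
  then show ?thesis by (rule has_sum_cong[THEN iffD1, rotated]) auto
qed

lemma lp_truncate:
  fixes f :: "'g \<Rightarrow> complex"
  assumes "lp r f" "0 < r" "0 < e"
  obtains S where "finite S" "lp r (\<lambda>x. if x \<in> S then 0 else f x)"
    "lpnorm r (\<lambda>x. if x \<in> S then 0 else f x) < e"
proof -
  let ?h = "\<lambda>x. norm (f x) powr r"
  have hs: "(?h has_sum infsum ?h UNIV) UNIV" using assms by (simp add: lp_def)
  have "0 < (e/2) powr r" using assms by simp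
  then obtain S where S: "finite S" "dist (sum ?h S) (infsum ?h UNIV) \<le> (e/2) powr r"
    using has_sum_finite_approximation[OF hs] by blast
  have t: "((\<lambda>x. norm (if x \<in> S then 0 else f x) powr r) has_sum (infsum ?h UNIV - sum ?h S)) UNIV"
    by (rule has_sum_cong[THEN iffD1, OF _ has_sum_remove_finite[OF hs S(1)]]) auto
  have "lpnorm r (\<lambda>x. if x \<in> S then 0 else f x) = (infsum ?h UNIV - sum ?h S) powr (1/r)"
    unfolding lpnorm_def infsumI[OF t] ..
  also have "\<dots> \<le> ((e/2) powr r) powr (1/r)"
    using S(2) has_sum_nonneg[OF t] assms by (intro powr_mono2) (auto simp: dist_real_def)
  also have "\<dots> < e" using assms by (simp add: powr_powr)
  finally show thesis using that S(1) has_sum_imp_summable[OF t] by (simp add: lp_def)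
qed

lemma finite_support_conv:
  fixes f g :: "'g::group_add \<Rightarrow> complex"
  assumes "finite {x. f x \<noteq> 0}" "finite {x. g x \<noteq> 0}"
  shows "finite {x. conv g (fcheck f) x \<noteq> 0}"
proof (rule finite_subset)
  show "{x. conv g (fcheck f) x \<noteq> 0} \<subseteq> (\<lambda>(y, z). y - z) ` ({x. g x \<noteq> 0} \<times> {x. f x \<noteq> 0})"
  proof
    fix x assume "x \<in> {x. conv g (fcheck f) x \<noteq> 0}"
    then have "\<exists>y. g y * f (- x + y) \<noteq> 0"
      unfolding conv_fcheck using infsum_0[of UNIV "\<lambda>y. g y * f (- x + y)"] by auto
    then obtain y where "g y \<noteq> 0" "f (- x + y) \<noteq> 0" by auto
    moreover have "x = y - (- x + y)" by (simp add: diff_conv_add_uminus minus_add del: add_uminus_conv_diff)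
    ultimately show "x \<in> (\<lambda>(y, z). y - z) ` ({x. g x \<noteq> 0} \<times> {x. f x \<noteq> 0})"
      by (intro image_eqI[of _ _ "(y, - x + y)"]) auto
  qed
qed (use assms in auto)

context
  fixes p :: real
  assumes p1: "1 < p"
begin

lemma Ap_point_mass: "(\<lambda>x::'g::group_add. if x = a then 1 else 0) \<in> Ap p"
proof -
  let ?d = "\<lambda>a x::'g. if x = a then 1 else (0::complex)"
  have "conv (?d a) (fcheck (?d 0)) x = ?d a x" for x
  proof -
    have "(\<Sum>\<^sub>\<infinity>y. ?d a y * ?d 0 (- x + y)) = (\<Sum>\<^sub>\<infinity>y\<in>{a}. ?d 0 (- x + y))"
      by (rule infsum_cong_neutral) auto
    also have "\<dots> = ?d a x"
      by (auto simp: neg_eq_iff_add_eq_0[symmetric])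
    finally show ?thesis by (simp add: conv_fcheck)
  qed
  then have "conv (?d a) (fcheck (?d 0)) = ?d a" by auto
  moreover have "conv (?d a) (fcheck (?d 0)) \<in> Ap p"
    by (intro Ap_conv[OF p1] lp_finite_support) auto
  ultimately show ?thesis by simp
qed

text \<open>Density of the finitely supported functions, arranged as an induction principle: a
  linear property that holds for point masses and passes to norm limits in A_p holds on all of
  A_p.\<close>

context
  fixes W :: "('g::group_add \<Rightarrow> complex) set"
  assumes W_point: "\<And>a. (\<lambda>x. if x = a then 1 else 0) \<in> W"
    and W_add: "\<And>u v. u \<in> W \<Longrightarrow> v \<in> W \<Longrightarrow> (\<lambda>x. u x + v x) \<in> W"
    and W_cmult: "\<And>c u. u \<in> W \<Longrightarrow> (\<lambda>x. c * u x) \<in> W"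
begin

lemma subspace_sum:
  assumes "finite I" "\<And>i. i \<in> I \<Longrightarrow> h i \<in> W"
  shows "(\<lambda>x. \<Sum>i\<in>I. c i * h i x) \<in> W"
  using assms
proof (induction I)
  case empty
  show ?case using W_cmult[OF W_point, of 0] by simp
next
  case (insert i I)
  then show ?case using W_add[OF W_cmult[of "h i" "c i"], of "\<lambda>x. \<Sum>i\<in>I. c i * h i x"] by simp
qed

lemma finite_support_in_subspace:
  assumes "finite {x. u x \<noteq> 0}"
  shows "u \<in> W"
proof -
  have "(\<Sum>i\<in>{x. u x \<noteq> 0}. u i * (if x = i then 1 else 0)) = u x" for x
    using assms by (simp add: if_distrib[of "\<lambda>t. _ * t"] sum.delta' cong: if_cong)
  then have "(\<lambda>x. \<Sum>i\<in>{x. u x \<noteq> 0}. u i * (if x = i then 1 else 0)) = u" by blast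
  then show ?thesis
    using subspace_sum[OF assms, of "\<lambda>i x. if x = i then 1 else 0" u] W_point by simp
qed

context
  assumes W_lim: "\<And>v. v \<in> Ap p \<Longrightarrow> (\<And>e. e > 0 \<Longrightarrow> \<exists>w\<in>W. Apnorm p (\<lambda>x. v x - w x) < e) \<Longrightarrow> v \<in> W"
begin

text \<open>The factors are truncated one at a time, here \<open>f\<close> and then
  \<open>g\<close>, so that the error is a single convolution with a small remainder. The 1 added to
  the norm of the other factor makes it a safe divisor.\<close>

lemma conv_left_finite_in_closed_subspace:
  assumes g: "finite {x. g x \<noteq> 0}" and f: "lp p f"
  shows "conv g (fcheck f) \<in> W"
proof (rule W_lim)
  note lg = lp_finite_support[OF g, of "conj_exp p"]
  show "conv g (fcheck f) \<in> Ap p" by (rule Ap_conv[OF p1 f lg])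
  fix e :: real assume e: "e > 0"
  let ?N = "lpnorm (conj_exp p) g + 1"
  have N: "?N > 0" using lpnorm_nonneg[of "conj_exp p" g] by linarith
  have p0: "0 < p" and eN: "0 < e / ?N" using p1 e N by auto
  obtain S where S: "finite S" "lp p (\<lambda>x. if x \<in> S then 0 else f x)"
    "lpnorm p (\<lambda>x. if x \<in> S then 0 else f x) < e / ?N"
    by (rule lp_truncate[OF f p0 eN]) (rule that)
  let ?fS = "\<lambda>x. if x \<in> S then f x else 0" and ?fR = "\<lambda>x. if x \<in> S then 0 else f x"
  have finS: "finite {x. ?fS x \<noteq> 0}" using S(1) by simp
  have "conv g (fcheck f) x - conv g (fcheck ?fS) x = conv g (fcheck ?fR) x" for x
  proof -
    have "(\<lambda>y. g y * f (- x + y)) summable_on UNIV" "(\<lambda>y. g y * ?fS (- x + y)) summable_on UNIV"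
      by (rule abs_summable_summable[OF conv_abs_summable[OF p1 f lg]],
          rule abs_summable_summable[OF conv_abs_summable[OF p1 lp_finite_support[OF finS] lg]])
    from has_sum_add[OF has_sum_infsum[OF this(1)] has_sum_uminusI[OF has_sum_infsum[OF this(2)]]]
    have "((\<lambda>y. g y * ?fR (- x + y)) has_sum conv g (fcheck f) x + - conv g (fcheck ?fS) x) UNIV"
      unfolding conv_fcheck by (rule has_sum_cong[THEN iffD1, rotated]) auto
    from infsumI[OF this] show ?thesis by (simp add: conv_fcheck)
  qed
  then have "(\<lambda>x. conv g (fcheck f) x - conv g (fcheck ?fS) x) = conv g (fcheck ?fR)" by blast
  moreover have "Apnorm p (conv g (fcheck ?fR)) < e"
  proof -
    have "Apnorm p (conv g (fcheck ?fR)) \<le> lpnorm p ?fR * lpnorm (conj_exp p) g"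
      by (rule Ap_conv[OF p1 S(2) lg])
    also have "\<dots> \<le> lpnorm p ?fR * ?N" by (intro mult_left_mono) auto
    also have "\<dots> < e" using S(3) N by (simp add: pos_less_divide_eq)
    finally show ?thesis .
  qed
  ultimately show "\<exists>w\<in>W. Apnorm p (\<lambda>x. conv g (fcheck f) x - w x) < e"
    using finite_support_in_subspace[OF finite_support_conv[OF finS g]] by (intro bexI[of _ "conv g (fcheck ?fS)"]) auto
qed

lemma conv_in_closed_subspace:
  assumes g: "lp (conj_exp p) g" and f: "lp p f"
  shows "conv g (fcheck f) \<in> W"
proof (rule W_lim)
  show "conv g (fcheck f) \<in> Ap p" by (rule Ap_conv[OF p1 f g])
  fix e :: real assume e: "e > 0"
  let ?N = "lpnorm p f + 1"
  have N: "?N > 0" using lpnorm_nonneg[of p f] by linarith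
  have q0: "0 < conj_exp p" and eN: "0 < e / ?N" using conj_exp_gt1[OF p1] e N by auto
  obtain S where S: "finite S" "lp (conj_exp p) (\<lambda>x. if x \<in> S then 0 else g x)"
    "lpnorm (conj_exp p) (\<lambda>x. if x \<in> S then 0 else g x) < e / ?N"
    by (rule lp_truncate[OF g q0 eN]) (rule that)
  let ?gS = "\<lambda>x. if x \<in> S then g x else 0" and ?gR = "\<lambda>x. if x \<in> S then 0 else g x"
  have finS: "finite {x. ?gS x \<noteq> 0}" using S(1) by simp
  have "conv g (fcheck f) x - conv ?gS (fcheck f) x = conv ?gR (fcheck f) x" for x
  proof -
    have "(\<lambda>y. g y * f (- x + y)) summable_on UNIV" "(\<lambda>y. ?gS y * f (- x + y)) summable_on UNIV"
      by (rule abs_summable_summable[OF conv_abs_summable[OF p1 f g]],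
          rule abs_summable_summable[OF conv_abs_summable[OF p1 f lp_finite_support[OF finS]]])
    from has_sum_add[OF has_sum_infsum[OF this(1)] has_sum_uminusI[OF has_sum_infsum[OF this(2)]]]
    have "((\<lambda>y. ?gR y * f (- x + y)) has_sum conv g (fcheck f) x + - conv ?gS (fcheck f) x) UNIV"
      unfolding conv_fcheck by (rule has_sum_cong[THEN iffD1, rotated]) auto
    from infsumI[OF this] show ?thesis by (simp add: conv_fcheck)
  qed
  then have "(\<lambda>x. conv g (fcheck f) x - conv ?gS (fcheck f) x) = conv ?gR (fcheck f)" by blast
  moreover have "Apnorm p (conv ?gR (fcheck f)) < e"
  proof -
    have "Apnorm p (conv ?gR (fcheck f)) \<le> lpnorm p f * lpnorm (conj_exp p) ?gR"
      by (rule Ap_conv[OF p1 f S(2)])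
    also have "\<dots> \<le> ?N * lpnorm (conj_exp p) ?gR" by (intro mult_right_mono) auto
    also have "\<dots> < e" using S(3) N by (simp add: pos_less_divide_eq mult.commute)
    finally show ?thesis .
  qed
  ultimately show "\<exists>w\<in>W. Apnorm p (\<lambda>x. conv g (fcheck f) x - w x) < e"
    using conv_left_finite_in_closed_subspace[OF finS f] by (intro bexI[of _ "conv ?gS (fcheck f)"]) auto
qed

lemma Ap_eq_closed_subspace: "v \<in> Ap p \<Longrightarrow> v \<in> W"
proof (rule W_lim)
  assume v: "v \<in> Ap p"
  fix e :: real assume e: "e > 0"
  \<comment> \<open>The cost of the representation need only be finite, so the crude slack 1 will
    do; smallness comes from dropping finitely many terms and using the tail as a representation of
    the error.\<close>
  have one: "0 < (1::real)" by simp
  obtain f g s where r: "\<And>i::nat. lp p (f i)" "\<And>i. lp (conj_exp p) (g i)"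
      "((\<lambda>i. lpnorm p (f i) * lpnorm (conj_exp p) (g i)) has_sum s) UNIV" "s < Apnorm p v + 1"
      "\<And>x. ((\<lambda>i. conv (g i) (fcheck (f i)) x) has_sum v x) UNIV"
    by (rule Ap_repE[OF p1 v one]) (rule that)
  have "0 < e / 2" using e by simp
  then obtain S where S: "finite S"
    "dist (\<Sum>i\<in>S. lpnorm p (f i) * lpnorm (conj_exp p) (g i)) s \<le> e / 2"
    using has_sum_finite_approximation[OF r(3)] by blast
  let ?f = "\<lambda>i. if i \<in> S then (\<lambda>_. 0) else f i" and ?w = "\<lambda>x. \<Sum>i\<in>S. 1 * conv (g i) (fcheck (f i)) x"
  have 1: "lp p (?f i)" for i using r(1) by simp
  have 2: "((\<lambda>i. lpnorm p (?f i) * lpnorm (conj_exp p) (g i)) has_sum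
      (s - (\<Sum>i\<in>S. lpnorm p (f i) * lpnorm (conj_exp p) (g i)))) UNIV"
    by (rule has_sum_cong[THEN iffD1, OF _ has_sum_remove_finite[OF r(3) S(1)]]) auto
  have 3: "((\<lambda>i. conv (g i) (fcheck (?f i)) x) has_sum (v x - ?w x)) UNIV" for x
    unfolding mult_1
    by (rule has_sum_cong[THEN iffD1, OF _ has_sum_remove_finite[OF r(5) S(1)]]) auto
  have "Apnorm p (\<lambda>x. v x - ?w x) \<le> s - (\<Sum>i\<in>S. lpnorm p (f i) * lpnorm (conj_exp p) (g i))"
    by (rule Ap_countable_repI(2)[OF p1 1 r(2) 2 3])
  also have "\<dots> < e" using S(2) e unfolding dist_real_def by linarith
  finally show "\<exists>w\<in>W. Apnorm p (\<lambda>x. v x - w x) < e"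
    using subspace_sum[OF S(1), of "\<lambda>i. conv (g i) (fcheck (f i))" "\<lambda>_. 1"] conv_in_closed_subspace r(1,2)
    by (intro bexI[of _ ?w]) auto
qed

end
end

text \<open>The set of good \<open>v\<close> is a linear space. It contains the point mass at a,
  which is merely multiplied by \<open>E k a\<close>, and it is closed under norm limits because
  multiplication by the \<open>E k\<close> is uniformly bounded by 1.\<close>

lemma approximate_identity_tendsto:
  fixes E :: "nat \<Rightarrow> 'g::{group_add,countable} \<Rightarrow> complex"
  assumes E: "\<And>k. E k \<in> Ap_ball p" "\<And>x. (\<lambda>k. E k x) \<longlonglongrightarrow> 1"
    and T: "T \<in> Ap_dual p" and v: "v \<in> Ap p"
  shows "(\<lambda>k. T (\<lambda>x. E k x * v x)) \<longlonglongrightarrow> T v"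
proof -
  define W where "W = {v \<in> Ap p. (\<lambda>k. T (\<lambda>x. E k x * v x)) \<longlonglongrightarrow> T v}"
  note EA = Ap_ballD(1)[OF p1 E(1)]
  note Ev = Ap_mult[OF p1 EA]
  have "v \<in> W"
  proof (rule Ap_eq_closed_subspace[OF _ _ _ _ v])
    show "(\<lambda>x. if x = a then 1 else 0) \<in> W" for a
    proof -
      let ?d = "\<lambda>x. if x = a then 1 else (0::complex)"
      have "(\<lambda>x. E k x * ?d x) = (\<lambda>x. E k a * ?d x)" for k by auto
      then have "T (\<lambda>x. E k x * ?d x) = E k a * T ?d" for k
        using Ap_dualD(2)[OF p1 T Ap_point_mass] by simp
      moreover have "(\<lambda>k. E k a * T ?d) \<longlonglongrightarrow> 1 * T ?d"
        by (intro tendsto_intros E)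
      ultimately show ?thesis by (simp add: W_def Ap_point_mass)
    qed
    show "(\<lambda>x. u x + v x) \<in> W" if "u \<in> W" "v \<in> W" for u v
    proof -
      have A: "u \<in> Ap p" "v \<in> Ap p" using that by (auto simp: W_def)
      have "T (\<lambda>x. E k x * (u x + v x)) = T (\<lambda>x. E k x * u x) + T (\<lambda>x. E k x * v x)" for k
        using Ap_dualD(1)[OF p1 T Ev[OF A(1)] Ev[OF A(2)]] by (simp add: distrib_left)
      then show ?thesis
        using that Ap_add[OF p1 A] Ap_dualD(1)[OF p1 T A] by (auto simp: W_def intro: tendsto_add)
    qed
    show "(\<lambda>x. c * u x) \<in> W" if "u \<in> W" for c u
    proof -
      have A: "u \<in> Ap p" using that by (auto simp: W_def)
      have "T (\<lambda>x. E k x * (c * u x)) = c * T (\<lambda>x. E k x * u x)" for k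
        using Ap_dualD(2)[OF p1 T Ev[OF A]] by (simp add: mult.left_commute)
      then show ?thesis
        using that Ap_cmult[OF p1 A] Ap_dualD(2)[OF p1 T A] by (auto simp: W_def intro: tendsto_mult_left)
    qed
    show "v \<in> W" if v: "v \<in> Ap p" and lim: "\<And>e. e > 0 \<Longrightarrow> \<exists>w\<in>W. Apnorm p (\<lambda>x. v x - w x) < e" for v
    proof -
      have "(\<lambda>k. T (\<lambda>x. E k x * v x)) \<longlonglongrightarrow> T v"
      proof (rule tendstoI)
        fix e :: real assume e: "e > 0"
        let ?D = "dual_norm p T + 1"
        have D: "?D > 0" using dual_norm_nonneg[OF p1 T] by linarith
        obtain w where w: "w \<in> W" "Apnorm p (\<lambda>x. v x - w x) < e / (3 * ?D)"
          using lim[of "e / (3 * ?D)"] e D by auto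
        have wA: "w \<in> Ap p" and wl: "(\<lambda>k. T (\<lambda>x. E k x * w x)) \<longlonglongrightarrow> T w" using w by (auto simp: W_def)
        note dA = Ap_diff[OF p1 v wA]
        let ?\<delta> = "Apnorm p (\<lambda>x. v x - w x)"
        have small: "dual_norm p T * ?\<delta> < e / 3"
        proof -
          have "dual_norm p T * ?\<delta> \<le> ?D * ?\<delta>"
            using Apnorm_nonneg[OF p1 dA] by (intro mult_right_mono) auto
          also have "\<dots> < e / 3" using w(2) D by (simp add: field_simps)
          finally show ?thesis .
        qed
        have a: "norm (T v - T w) < e / 3"
          using dual_norm_bound[OF p1 T dA] small unfolding Ap_dual_diff[OF p1 T v wA] by simp
        have b: "norm (T (\<lambda>x. E k x * v x) - T (\<lambda>x. E k x * w x)) < e / 3" for k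
        proof -
          have "T (\<lambda>x. E k x * v x) - T (\<lambda>x. E k x * w x) = dual_act_r p T (E k) (\<lambda>x. v x - w x)"
            using Ap_dual_diff[OF p1 T Ev[OF v] Ev[OF wA], of k k] dA by (simp add: dual_act_r_def right_diff_distrib)
          also have "norm \<dots> \<le> dual_norm p (dual_act_r p T (E k)) * ?\<delta>"
            by (rule dual_norm_bound[OF p1 dual_act_r_dual[OF p1 T EA] dA])
          also have "\<dots> \<le> dual_norm p T * ?\<delta>"
          proof (rule mult_right_mono[OF _ Apnorm_nonneg[OF p1 dA]])
            show "dual_norm p (dual_act_r p T (E k)) \<le> dual_norm p T"
              using dual_norm_act_r[OF p1 T EA] mult_left_le[OF Ap_ballD(2)[OF p1 E(1)] dual_norm_nonneg[OF p1 T]]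
              by (rule order_trans)
          qed
          finally show ?thesis using small by simp
        qed
        have "eventually (\<lambda>k. dist (T (\<lambda>x. E k x * w x)) (T w) < e / 3) sequentially"
          using wl e by (intro tendstoD) auto
        then show "eventually (\<lambda>k. dist (T (\<lambda>x. E k x * v x)) (T v) < e) sequentially"
        proof eventually_elim
          case (elim k)
          let ?a = "T (\<lambda>x. E k x * v x)" and ?b = "T (\<lambda>x. E k x * w x)"
          have "dist ?a (T v) \<le> dist ?a ?b + dist ?b (T v)" "dist ?b (T v) \<le> dist ?b (T w) + dist (T w) (T v)"
            by (rule dist_triangle)+
          moreover have "dist ?a ?b < e / 3" using b[of k] by (simp add: dist_norm)
          moreover have "dist (T w) (T v) < e / 3" using a by (simp add: dist_norm norm_minus_commute)
          ultimately show ?case using elim by simp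
        qed
      qed
      with v show ?thesis by (simp add: W_def)
    qed
  qed
  then show ?thesis by (simp add: W_def)
qed

text \<open>For finitely supported \<open>u\<close> the product \<open>u v\<close> is a finite
  combination of point masses, so T(uv) is the sum of u(a) T(\<delta>_a) v(a), where \<delta>_a is
  the point mass at a. Submultiplicativity keeps the norm at most 1.\<close>

lemma dual_act_r_in_Zp:
  fixes u :: "'g::{group_add,countable} \<Rightarrow> complex"
  assumes u: "u \<in> Ap_ball p" "finite {x. u x \<noteq> 0}" and T: "T \<in> Yp p"
  shows "dual_act_r p T u \<in> Zp p"
proof -
  have Td: "T \<in> Ap_dual p" "dual_norm p T \<le> 1" using T by (auto simp: Yp_def)
  note uA = Ap_ballD[OF p1 u(1)]
  note d = dual_act_r_dual[OF p1 Td(1) uA(1)]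
  have "dual_norm p T * Apnorm p u \<le> 1"
    using Td uA dual_norm_nonneg[OF p1 Td(1)] Apnorm_nonneg[OF p1 uA(1)] by (intro mult_le_one)
  then have n: "dual_norm p (dual_act_r p T u) \<le> 1"
    using dual_norm_act_r[OF p1 Td(1) uA(1)] by simp
  let ?d = "\<lambda>a x. if x = a then 1 else (0::complex)"
  define c where "c a = u a * T (?d a)" for a
  have sub: "{a. c a \<noteq> 0} \<subseteq> {a. u a \<noteq> 0}" by (auto simp: c_def)
  have "dual_act_r p T u v = (\<Sum>a\<in>{a. c a \<noteq> 0}. c a * v a)" if v: "v \<in> Ap p" for v
  proof -
    have *: "(\<lambda>x. \<Sum>a\<in>A. (u a * v a) * ?d a x) \<in> Ap p \<and>
        T (\<lambda>x. \<Sum>a\<in>A. (u a * v a) * ?d a x) = (\<Sum>a\<in>A. c a * v a)" if "finite A" for A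
      using that
    proof (induction A)
      case empty
      show ?case by (simp add: Ap_zero[OF p1] Ap_dual_zero[OF p1 Td(1)])
    next
      case (insert a A)
      note k = Ap_cmult[OF p1 Ap_point_mass, of "u a * v a" a]
      have i: "(\<lambda>x. \<Sum>a\<in>insert a A. (u a * v a) * ?d a x) =
          (\<lambda>x. (u a * v a) * ?d a x + (\<Sum>a\<in>A. (u a * v a) * ?d a x))"
        using insert by (simp add: fun_eq_iff)
      have "T (\<lambda>x. (u a * v a) * ?d a x) = c a * v a"
        unfolding Ap_dualD(2)[OF p1 Td(1) Ap_point_mass] by (simp add: c_def)
      then show ?case
        unfolding i using insert Ap_add[OF p1 k conjunct1[OF insert.IH]]
          Ap_dualD(1)[OF p1 Td(1) k conjunct1[OF insert.IH]] by simp
    qed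
    have "(\<Sum>a\<in>{a. u a \<noteq> 0}. (u a * v a) * ?d a x) = u x * v x" for x
      using u(2) by (simp add: if_distrib[of "\<lambda>t. _ * t"] sum.delta' cong: if_cong)
    then have "(\<lambda>x. \<Sum>a\<in>{a. u a \<noteq> 0}. (u a * v a) * ?d a x) = (\<lambda>x. u x * v x)" by blast
    then have "dual_act_r p T u v = (\<Sum>a\<in>{a. u a \<noteq> 0}. c a * v a)"
      using *[OF u(2)] v by (simp add: dual_act_r_def)
    also have "\<dots> = (\<Sum>a\<in>{a. c a \<noteq> 0}. c a * v a)"
      by (rule sum.mono_neutral_right[OF u(2) sub]) auto
    finally show ?thesis .
  qed
  then have "dual_act_r p T u \<in> Xp p"
    using d finite_subset[OF sub u(2)] by (auto simp: Xp_def)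
  with d n show ?thesis by (simp add: Zp_def Yp_def)
qed

end

section \<open>Amenability and approximate identities\<close>

text \<open>The \<open>\<ell>\<^sub>1\<close> distance between \<open>h\<close> and its left
  translate by \<open>x\<close>.\<close>

definition l1_shift :: "('g::group_add \<Rightarrow> real) \<Rightarrow> 'g \<Rightarrow> real" where
  "l1_shift h x = (\<Sum>\<^sub>\<infinity>z. \<bar>h (- x + z) - h z\<bar>)"

lemma finite_support_shift:
  fixes h :: "'g::group_add \<Rightarrow> 'b::zero"
  assumes "finite {x. h x \<noteq> 0}"
  shows "finite {z. h (- x + z) \<noteq> 0}"
proof (rule finite_subset)
  show "{z. h (- x + z) \<noteq> 0} \<subseteq> (\<lambda>y. x + y) ` {x. h x \<noteq> 0}"
  proof
    fix z assume "z \<in> {z. h (- x + z) \<noteq> 0}"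
    then show "z \<in> (\<lambda>y. x + y) ` {x. h x \<noteq> 0}"
      by (intro image_eqI[of _ _ "- x + z"]) (auto simp flip: add.assoc)
  qed
qed (use assms in simp)

lemma finite_support_summable:
  fixes a :: "'g \<Rightarrow> real"
  assumes "finite {x. h x \<noteq> (0::real)}" "\<And>x. h x = 0 \<Longrightarrow> a x = 0"
  shows "a summable_on UNIV"
  by (rule finite_nonzero_values_imp_summable_on) (rule finite_subset[OF _ assms(1)], use assms(2) in auto)

lemma infsum_shift:
  fixes a :: "'g::group_add \<Rightarrow> 'b::{comm_monoid_add,t2_space}"
  shows "(\<Sum>\<^sub>\<infinity>y. a (x + y)) = (\<Sum>\<^sub>\<infinity>z. a z)"
  by (rule infsum_reindex_bij_betw[OF bij_plus_left])

lemma mean_sum: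
  assumes add: "\<And>f g. bounded (range f) \<Longrightarrow> bounded (range g) \<Longrightarrow> m (\<lambda>x. f x + g x) = m f + m g"
    and cm: "\<And>c f. bounded (range f) \<Longrightarrow> m (\<lambda>x. c * f x) = c * m f"
    and "finite K" and b: "\<And>k x. \<bar>a k x\<bar> \<le> C"
  shows "m (\<lambda>x::'g. \<Sum>k\<in>K. a k x) = (\<Sum>k\<in>K. m (a k) :: real)"
  using \<open>finite K\<close>
proof (induction K)
  case empty
  have "bounded (range (\<lambda>x::'g. 0::real))" by (rule boundedI[of _ 0]) auto
  from cm[OF this, of 0] show ?case by simp
next
  case (insert k K)
  have "\<bar>\<Sum>k\<in>K. a k x\<bar> \<le> (\<Sum>k\<in>K. C)" for x
    by (rule order_trans[OF sum_abs sum_mono]) (rule b)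
  then have "bounded (range (\<lambda>x. \<Sum>k\<in>K. a k x))" by (intro boundedI[of _ "\<Sum>k\<in>K. C"]) auto
  moreover have "bounded (range (a k))" using b by (intro boundedI[of _ C]) auto
  ultimately show ?case using insert add by simp
qed

text \<open>If the conclusion fails, finite-dimensional separation produces for every finite set \<open>Y\<close> some
  \<open>\<phi>\<close> in the unit ball of \<open>\<ell>\<^sub>\<infinity>(G)\<^sup>K\<close> whose coboundary \<open>\<psi> \<phi> y = \<Sum>x. \<phi> x (x + y) - \<phi> x y\<close> is at
  least \<open>e / 2\<close> on \<open>Y\<close>; an ultrafilter limit makes this hold on all of \<open>G\<close>. But an
  invariant mean annihilates \<open>\<psi> \<phi>\<close>.\<close>

lemma Reiter_condition:
  assumes am: "amenable TYPE('g::{group_add,countable})" and K: "finite K" and e: "e > 0"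
  shows "\<exists>h::'g \<Rightarrow> real. finite {x. h x \<noteq> 0} \<and> (\<forall>x. 0 \<le> h x) \<and> (\<Sum>\<^sub>\<infinity>x. h x) = 1 \<and>
           (\<forall>x\<in>K. l1_shift h x < e)"
proof (rule ccontr)
  assume no: "\<not> ?thesis"
  have nonneg: "0 \<le> l1_shift h x" for h :: "'g \<Rightarrow> real" and x
    unfolding l1_shift_def by (intro infsum_nonneg) auto
  \<comment> \<open>Rescaling turns the failure of the conclusion for probability functions into a
    homogeneous inequality for all nonnegative \<open>h\<close>, including 0; the violating x in
    \<open>K\<close> is absorbed into a sum over \<open>K\<close>.\<close>
  have big: "e * (\<Sum>\<^sub>\<infinity>x. h x) \<le> (\<Sum>x\<in>K. l1_shift h x)"
    if h: "finite {x. h x \<noteq> 0}" "\<And>x. 0 \<le> h x" for h :: "'g \<Rightarrow> real"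
  proof (cases "(\<Sum>\<^sub>\<infinity>x. h x) = 0")
    case True
    then show ?thesis by (simp add: sum_nonneg nonneg)
  next
    case False
    let ?s = "\<Sum>\<^sub>\<infinity>x. h x" and ?h = "\<lambda>x. inverse (\<Sum>\<^sub>\<infinity>x. h x) * h x"
    have pos: "?s > 0" using False infsum_nonneg[of UNIV h] h by (simp add: less_le)
    have fin: "finite {x. ?h x \<noteq> 0}" using finite_subset[OF _ h(1)] by auto
    have sh: "l1_shift ?h x = inverse ?s * l1_shift h x" for x
      unfolding l1_shift_def right_diff_distrib[symmetric] abs_mult using pos
      by (simp add: infsum_cmult_right')
    have "(\<Sum>\<^sub>\<infinity>x. ?h x) = 1" using pos by (simp add: infsum_cmult_right')
    moreover have "\<forall>x. 0 \<le> ?h x" using pos h by simp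
    ultimately obtain x where x: "x \<in> K" "e \<le> l1_shift ?h x" using no fin by (meson not_less)
    then have "e \<le> inverse ?s * l1_shift h x" by (simp only: sh)
    then have "e * ?s \<le> l1_shift h x" using pos by (simp add: field_simps)
    also have "\<dots> \<le> (\<Sum>x\<in>K. l1_shift h x)" using x K nonneg by (intro member_le_sum) auto
    finally show ?thesis .
  qed
  define \<psi> where "\<psi> \<phi> y = (\<Sum>x\<in>K. \<phi> x (x + y) - \<phi> x y)" for \<phi> :: "'g \<Rightarrow> 'g \<Rightarrow> real" and y
  define \<Phi> where "\<Phi> = {\<phi> :: 'g \<Rightarrow> 'g \<Rightarrow> real. \<forall>x z. \<bar>\<phi> x z\<bar> \<le> 1}"
  define R where "R = 2 * real (card K)"
  have \<psi>_bound: "\<bar>\<psi> \<phi> y\<bar> \<le> R" if "\<phi> \<in> \<Phi>" for \<phi> y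
  proof -
    have "\<bar>\<psi> \<phi> y\<bar> \<le> (\<Sum>x\<in>K. \<bar>\<phi> x (x + y) - \<phi> x y\<bar>)" unfolding \<psi>_def by (rule sum_abs)
    also have "\<dots> \<le> (\<Sum>x\<in>K. 2)"
    proof (rule sum_mono)
      fix x
      have "\<bar>\<phi> x (x + y)\<bar> \<le> 1" "\<bar>\<phi> x y\<bar> \<le> 1" using that by (auto simp: \<Phi>_def)
      then show "\<bar>\<phi> x (x + y) - \<phi> x y\<bar> \<le> 2" by linarith
    qed
    finally show ?thesis by (simp add: R_def)
  qed
  \<comment> \<open>Duality of summable and bounded functions: after moving the translation from
    \<phi> to \<open>h\<close>, the sign of \<open>h (- x + z) - h z\<close> attains the
    norm.\<close>
  have duality: "\<exists>\<phi>\<in>\<Phi>. (\<Sum>\<^sub>\<infinity>y. h y * \<psi> \<phi> y) = (\<Sum>x\<in>K. l1_shift h x)"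
    if h: "finite {x. h x \<noteq> 0}" for h :: "'g \<Rightarrow> real"
  proof -
    define \<phi> where "\<phi> x z = sgn (h (- x + z) - h z)" for x z
    have s1: "(\<lambda>y. h y * \<phi> x (x + y)) summable_on UNIV" for x
      by (rule finite_support_summable[OF h]) simp
    have s2: "(\<lambda>y. h y * \<phi> x y) summable_on UNIV" for x
      by (rule finite_support_summable[OF h]) simp
    have s3: "(\<lambda>z. h (- x + z) * \<phi> x z) summable_on UNIV" for x
      by (rule finite_support_summable[OF finite_support_shift[OF h, of x]]) simp
    have i: "(\<Sum>\<^sub>\<infinity>y. h y * (\<phi> x (x + y) - \<phi> x y)) = l1_shift h x" for x
    proof -
      have "(\<Sum>\<^sub>\<infinity>y. h y * (\<phi> x (x + y) - \<phi> x y)) = (\<Sum>\<^sub>\<infinity>y. h y * \<phi> x (x + y)) - (\<Sum>\<^sub>\<infinity>y. h y * \<phi> x y)"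
        unfolding right_diff_distrib using infsum_add[OF s1 summable_on_uminus[THEN iffD2, OF s2]]
        by (simp add: infsum_uminus)
      also have "(\<Sum>\<^sub>\<infinity>y. h y * \<phi> x (x + y)) = (\<Sum>\<^sub>\<infinity>z. h (- x + z) * \<phi> x z)"
        using infsum_shift[of "\<lambda>z. h (- x + z) * \<phi> x z" x] by (simp flip: add.assoc)
      also have "\<dots> - (\<Sum>\<^sub>\<infinity>y. h y * \<phi> x y) = (\<Sum>\<^sub>\<infinity>z. (h (- x + z) - h z) * \<phi> x z)"
        unfolding left_diff_distrib using infsum_add[OF s3 summable_on_uminus[THEN iffD2, OF s2]]
        by (simp add: infsum_uminus)
      also have "\<dots> = l1_shift h x"
        unfolding l1_shift_def \<phi>_def by (simp add: abs_sgn)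
      finally show ?thesis .
    qed
    have "(\<Sum>\<^sub>\<infinity>y. h y * \<psi> \<phi> y) = (\<Sum>\<^sub>\<infinity>y\<in>{x. h x \<noteq> 0}. h y * \<psi> \<phi> y)"
      by (rule infsum_cong_neutral) auto
    also have "\<dots> = (\<Sum>x\<in>K. \<Sum>y\<in>{x. h x \<noteq> 0}. h y * (\<phi> x (x + y) - \<phi> x y))"
      unfolding \<psi>_def sum_distrib_left using h by (simp, subst sum.swap) simp
    also have "\<dots> = (\<Sum>x\<in>K. l1_shift h x)"
    proof (rule sum.cong[OF refl])
      fix x
      have "(\<Sum>y\<in>{x. h x \<noteq> 0}. h y * (\<phi> x (x + y) - \<phi> x y)) = (\<Sum>\<^sub>\<infinity>y. h y * (\<phi> x (x + y) - \<phi> x y))"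
        unfolding infsum_finite[OF h, symmetric] by (rule infsum_cong_neutral) auto
      then show "(\<Sum>y\<in>{x. h x \<noteq> 0}. h y * (\<phi> x (x + y) - \<phi> x y)) = l1_shift h x" using i by simp
    qed
    finally show ?thesis
      by (intro bexI[of _ \<phi>]) (auto simp: \<Phi>_def \<phi>_def sgn_if)
  qed
  have fin_ex: "\<exists>\<phi>\<in>\<Phi>. \<forall>y\<in>Y. e / 2 \<le> \<psi> \<phi> y" if Y: "finite Y" for Y
  proof (rule ccontr)
    assume far: "\<not> ?thesis"
    txt \<open>Subtracting the slack \<open>s\<close> makes the separating vector effectively nonnegative.\<close>
    define k where "k \<phi> s y = \<psi> \<phi> y - s y" for \<phi> and s :: "'g \<Rightarrow> real" and y
    define KS where "KS = {k \<phi> s | \<phi> s. \<phi> \<in> \<Phi> \<and> (\<forall>y. 0 \<le> s y \<and> s y \<le> R)}"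
    have R0: "R \<ge> 0" by (simp add: R_def)
    have zero: "(\<lambda>_ _. 0) \<in> \<Phi>" by (simp add: \<Phi>_def)
    have "\<exists>\<phi> s. \<phi> \<in> \<Phi> \<and> (\<forall>y::'g. 0 \<le> s y \<and> s y \<le> R)"
      using zero R0 by (intro exI[of _ "\<lambda>_ _. 0"] exI[of _ "\<lambda>_. 0"]) simp
    then have ne: "KS \<noteq> {}" unfolding KS_def by blast
    have cvx: "(\<lambda>i. (1 - t) * c i + t * c' i) \<in> KS" if c: "c \<in> KS" "c' \<in> KS" and t: "0 \<le> t" "t \<le> 1" for c c' t
    proof -
      obtain \<phi> s where 1: "c = k \<phi> s" "\<phi> \<in> \<Phi>" "\<And>y. 0 \<le> s y" "\<And>y. s y \<le> R" using c(1) by (auto simp: KS_def)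
      obtain \<phi>' s' where 2: "c' = k \<phi>' s'" "\<phi>' \<in> \<Phi>" "\<And>y. 0 \<le> s' y" "\<And>y. s' y \<le> R" using c(2) by (auto simp: KS_def)
      have "(\<lambda>i. (1 - t) * c i + t * c' i) = k (\<lambda>x z. (1 - t) * \<phi> x z + t * \<phi>' x z) (\<lambda>y. (1 - t) * s y + t * s' y)"
        unfolding 1(1) 2(1) k_def \<psi>_def
        by (simp add: fun_eq_iff right_diff_distrib sum_distrib_left sum.distrib sum_subtractf algebra_simps)
      moreover have "(\<lambda>x z. (1 - t) * \<phi> x z + t * \<phi>' x z) \<in> \<Phi>"
        unfolding \<Phi>_def
      proof (intro CollectI allI)
        fix x z
        have "\<bar>(1 - t) * \<phi> x z + t * \<phi>' x z\<bar> \<le> (1 - t) * \<bar>\<phi> x z\<bar> + t * \<bar>\<phi>' x z\<bar>"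
          using t abs_triangle_ineq[of "(1 - t) * \<phi> x z" "t * \<phi>' x z"] by (simp add: abs_mult)
        also have "\<dots> \<le> 1" using t 1(2) 2(2) by (intro convex_bound_le) (auto simp: \<Phi>_def)
        finally show "\<bar>(1 - t) * \<phi> x z + t * \<phi>' x z\<bar> \<le> 1" .
      qed
      moreover have "0 \<le> (1 - t) * s y + t * s' y \<and> (1 - t) * s y + t * s' y \<le> R" for y
        using t 1 2 by (auto intro!: convex_bound_le add_nonneg_nonneg mult_nonneg_nonneg)
      ultimately show ?thesis unfolding KS_def by blast
    qed
    have bnd: "\<bar>c y\<bar> \<le> 2 * R" if "c \<in> KS" "y \<in> Y" for c y
    proof -
      obtain \<phi> s where 1: "c = k \<phi> s" "\<phi> \<in> \<Phi>" "0 \<le> s y" "s y \<le> R" using \<open>c \<in> KS\<close> by (auto simp: KS_def)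
      then show ?thesis using \<psi>_bound[OF 1(2), of y] by (simp add: k_def)
    qed
    \<comment> \<open>The target is the constant \<open>e\<close>. A point \<psi> \<phi> - s closer
      than e/2 to it on all of \<open>Y\<close> would have \<psi> \<phi> > e/2 there, because s
      \<ge> 0, and this was excluded.\<close>
    have away: "\<exists>y\<in>Y. e / 2 \<le> \<bar>c y - e\<bar>" if "c \<in> KS" for c
    proof -
      obtain \<phi> s where 1: "c = k \<phi> s" "\<phi> \<in> \<Phi>" "\<And>y. 0 \<le> s y" using \<open>c \<in> KS\<close> by (auto simp: KS_def)
      obtain y where y: "y \<in> Y" "\<psi> \<phi> y < e / 2" using far 1(2) by (auto simp: not_le)
      have "e / 2 \<le> \<bar>\<psi> \<phi> y - s y - e\<bar>" using y(2) 1(3)[of y] by linarith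
      then show ?thesis using y(1) by (auto simp: 1(1) k_def)
    qed
    have e2: "e / 2 > 0" using e by simp
    have "\<exists>w. \<exists>\<beta>>0. \<forall>c\<in>KS. (\<Sum>y\<in>Y. w y * c y) + \<beta> \<le> (\<Sum>y\<in>Y. w y * e)"
      by (rule approx_separation[where I = Y and C = KS and e = "e / 2" and B = "2 * R" and z = "\<lambda>_. e"])
         (fact Y ne cvx bnd away e2)+
    then obtain w \<beta> where "\<beta> > 0" and sep: "\<And>c. c \<in> KS \<Longrightarrow> (\<Sum>y\<in>Y. w y * c y) + \<beta> \<le> (\<Sum>y\<in>Y. w y * e)" by blast
    define h where "h y = (if y \<in> Y then max (w y) 0 else 0)" for y
    have hfin: "finite {y. h y \<noteq> 0}" by (rule finite_subset[OF _ Y]) (auto simp: h_def)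
    have h0: "0 \<le> h y" for y by (simp add: h_def)
    have hY: "(\<Sum>\<^sub>\<infinity>y. h y * a y) = (\<Sum>y\<in>Y. h y * a y)" for a
      unfolding infsum_finite[OF Y, symmetric] by (rule infsum_cong_neutral) (auto simp: h_def)
    obtain \<phi> where \<phi>: "\<phi> \<in> \<Phi>" "(\<Sum>\<^sub>\<infinity>y. h y * \<psi> \<phi> y) = (\<Sum>x\<in>K. l1_shift h x)" using duality[OF hfin] by blast
    define s where "s y = (if w y < 0 then R else 0)" for y
    have "\<forall>y. 0 \<le> s y \<and> s y \<le> R" using R0 by (simp add: s_def)
    then have "k \<phi> s \<in> KS" unfolding KS_def using \<phi>(1) by blast
    note sp = sep[OF this]
    have "e * (\<Sum>y\<in>Y. h y) \<le> (\<Sum>y\<in>Y. h y * \<psi> \<phi> y)"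
    proof -
      have "(\<Sum>\<^sub>\<infinity>y. h y) = (\<Sum>y\<in>Y. h y)" using hY[of "\<lambda>_. 1"] by simp
      then show ?thesis using big[OF hfin h0] unfolding \<phi>(2)[symmetric] hY by simp
    qed
    also have "\<dots> \<le> (\<Sum>y\<in>Y. w y * k \<phi> s y)"
    proof (rule sum_mono)
      fix y assume y: "y \<in> Y"
      show "h y * \<psi> \<phi> y \<le> w y * k \<phi> s y"
      proof (cases "w y < 0")
        case True
        then have "0 \<le> w y * (\<psi> \<phi> y - R)" using \<psi>_bound[OF \<phi>(1), of y] by (intro mult_nonpos_nonpos) auto
        then show ?thesis using True y by (simp add: h_def k_def s_def)
      next
        case False
        then show ?thesis using y by (simp add: h_def k_def s_def)
      qed
    qed
    also have "\<dots> < (\<Sum>y\<in>Y. w y * e)" using sp \<open>\<beta> > 0\<close> by simp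
    also have "\<dots> \<le> (\<Sum>y\<in>Y. h y * e)" using e by (intro sum_mono mult_right_mono) (auto simp: h_def)
    also have "\<dots> = e * (\<Sum>y\<in>Y. h y)" by (simp add: sum_distrib_left mult.commute)
    finally show False by simp
  qed
  \<comment> \<open>These finite sets exhaust G. For a fixed y the bound holds for every n >
    \<open>to_nat y\<close>, so it survives the ultrafilter limit.\<close>
  have "\<forall>n. \<exists>\<phi>\<in>\<Phi>. \<forall>y\<in>{y. to_nat y < n}. e / 2 \<le> \<psi> \<phi> y"
    using fin_ex[OF finite_to_nat_less] by blast
  then obtain \<phi>s where \<phi>s: "\<And>n. \<phi>s n \<in> \<Phi>" "\<And>n y. to_nat y < n \<Longrightarrow> e / 2 \<le> \<psi> (\<phi>s n) y"
    by (auto simp: choice_iff Bex_def)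
  define \<phi> where "\<phi> x z = ulim (\<lambda>n. \<phi>s n x z)" for x z
  have b1: "norm (\<phi>s n x z) \<le> 1" for n x z using \<phi>s(1) by (auto simp: \<Phi>_def)
  have lim: "((\<lambda>n. \<phi>s n x z) \<longlongrightarrow> \<phi> x z) free_ultra" for x z
    unfolding \<phi>_def by (rule bounded_tendsto_ulim[OF b1])
  have \<phi>: "\<bar>\<phi> x z\<bar> \<le> 1" for x z using norm_ulim_le[of "\<lambda>n. \<phi>s n x z", OF b1] by (simp add: \<phi>_def)
  have \<psi>: "e / 2 \<le> \<psi> \<phi> y" for y
  proof (rule tendsto_lowerbound)
    show "((\<lambda>n. \<psi> (\<phi>s n) y) \<longlongrightarrow> \<psi> \<phi> y) free_ultra"
      unfolding \<psi>_def by (intro tendsto_intros lim)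
    show "eventually (\<lambda>n. e / 2 \<le> \<psi> (\<phi>s n) y) free_ultra"
      using eventually_free_ultra_gt[of "to_nat y"] by eventually_elim (rule \<phi>s(2))
  qed simp
  obtain m :: "('g \<Rightarrow> real) \<Rightarrow> real" where
    m: "\<forall>f g. bounded (range f) \<longrightarrow> bounded (range g) \<longrightarrow> m (\<lambda>x. f x + g x) = m f + m g"
      "\<forall>c f. bounded (range f) \<longrightarrow> m (\<lambda>x. c * f x) = c * m f"
      "\<forall>f. bounded (range f) \<longrightarrow> (\<forall>x. 0 \<le> f x) \<longrightarrow> 0 \<le> m f"
    and m_one: "m (\<lambda>_. 1) = 1"
    and m_inv: "\<forall>f y. bounded (range f) \<longrightarrow> m (\<lambda>x. f (y + x)) = m f"
    using am unfolding amenable_def by (elim exE conjE) (rule that)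
  note m_add = m(1)[rule_format] and m_cm = m(2)[rule_format] and m_pos = m(3)[rule_format]
    and m_inv = m_inv[rule_format]
  have bd: "bounded (range f)" if "\<And>x. \<bar>f x\<bar> \<le> C" for f :: "'g \<Rightarrow> real" and C
    using that by (intro boundedI[of _ C]) auto
  have m0: "m (\<lambda>y. \<phi> x (x + y) - \<phi> x y) = 0" for x
  proof -
    have "m (\<lambda>y. \<phi> x (x + y) + (- 1) * \<phi> x y) = m (\<lambda>y. \<phi> x (x + y)) + m (\<lambda>y. (- 1) * \<phi> x y)"
      by (rule m_add) (rule bd[where C = 1], use \<phi> in simp)+
    also have "\<dots> = 0" unfolding m_inv[of "\<phi> x" x, OF bd[OF \<phi>]] m_cm[OF bd[OF \<phi>]] by simp
    finally show ?thesis by simp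
  qed
  have "m (\<psi> \<phi>) = (\<Sum>x\<in>K. m (\<lambda>y. \<phi> x (x + y) - \<phi> x y))"
    unfolding \<psi>_def[abs_def]
  proof (rule mean_sum[where C = 2])
    show "\<bar>\<phi> x (x + y) - \<phi> x y\<bar> \<le> 2" for x y
      using \<phi>[of x "x + y"] \<phi>[of x y] by linarith
  qed (fact m_add m_cm K)+
  also have "\<dots> = 0" by (simp add: m0)
  finally have "m (\<psi> \<phi>) = 0" .
  have \<Phi>\<phi>: "\<phi> \<in> \<Phi>" using \<phi> by (simp add: \<Phi>_def)
  have b\<psi>: "bounded (range (\<psi> \<phi>))" by (rule bd[OF \<psi>_bound[OF \<Phi>\<phi>]])
  have b1: "bounded (range (\<lambda>_::'g. 1::real))" by (rule bd[of _ 1]) simp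
  have bc: "bounded (range (\<lambda>_::'g. (- (e / 2)) * 1))" by (rule bd[of _ "e/2"]) (use e in simp)
  have "0 \<le> m (\<lambda>y. \<psi> \<phi> y + (- (e / 2)) * 1)"
  proof (rule m_pos)
    show "bounded (range (\<lambda>y. \<psi> \<phi> y + (- (e / 2)) * 1))"
      by (rule bounded_plus_comp[OF b\<psi> bc])
    show "0 \<le> \<psi> \<phi> y + (- (e / 2)) * 1" for y using \<psi>[of y] by simp
  qed
  also have "\<dots> = m (\<psi> \<phi>) + (- (e / 2)) * m (\<lambda>_. 1)"
    by (simp only: m_add[OF b\<psi> bc] m_cm[OF b1])
  also have "\<dots> < 0" using \<open>m (\<psi> \<phi>) = 0\<close> m_one e by simp
  finally show False by simp
qed

section \<open>Finitely supported approximate identities in the unit ball\<close>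

lemma min_le_powr_mult:
  fixes a b :: real
  assumes "0 \<le> a" "0 \<le> b" "0 < r" "0 < s" "r + s = 1"
  shows "min a b \<le> a powr r * b powr s"
proof -
  have "min a b = min a b powr r * min a b powr s"
    using assms by (simp add: powr_add[symmetric])
  also have "\<dots> \<le> a powr r * b powr s"
    using assms by (intro mult_mono powr_mono2) auto
  finally show ?thesis .
qed

text \<open>The value u(x) is a sum of weighted geometric means of h(y) and h(-x+y), each at least
  their minimum. As 2 min(a, b) = a + b - |a - b|, this gives 1 - u(x) \<le>
  \<open>l1_shift h x / 2\<close>. The reverse estimate u(x) \<le> 1 holds because point evaluations
  are contractive on A_p.\<close>

lemma finite_approximate_identity:
  assumes p1: "1 < p" and am: "amenable TYPE('g::{group_add,countable})" and K: "finite K" and e: "e > 0"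
  shows "\<exists>u::'g \<Rightarrow> complex. u \<in> Ap_ball p \<and> finite {x. u x \<noteq> 0} \<and> (\<forall>x\<in>K. norm (u x - 1) < e)"
proof -
  obtain h :: "'g \<Rightarrow> real" where fin: "finite {x. h x \<noteq> 0}" and h0: "\<And>x. 0 \<le> h x"
    and h1: "(\<Sum>\<^sub>\<infinity>x. h x) = 1" and sh: "\<And>x. x \<in> K \<Longrightarrow> l1_shift h x < e"
    using Reiter_condition[OF am K e] by blast
  define q where "q = conj_exp p"
  have q: "1 < q" "1 / p + 1 / q = 1" unfolding q_def using conj_exp_gt1[OF p1] conj_exp_sum[OF p1] .
  define f where "f y = complex_of_real (h y powr (1 / p))" for y
  define g where "g y = complex_of_real (h y powr (1 / q))" for y
  define u where "u = conv g (fcheck f)"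
  have supp: "{x. f x \<noteq> 0} = {x. h x \<noteq> 0}" "{x. g x \<noteq> 0} = {x. h x \<noteq> 0}"
    by (auto simp: f_def g_def)
  have lf: "lp p f" "lp q g" using supp fin by (auto intro: lp_finite_support)
  have "lpnorm p f = 1" "lpnorm q g = 1"
    using p1 q h0 h1 by (simp_all add: lpnorm_def f_def g_def powr_powr)
  then have ball: "u \<in> Ap_ball p"
    using Ap_conv[OF p1 lf(1) lf(2)[unfolded q_def]] by (simp add: Ap_ball_def u_def q_def)
  have usupp: "finite {x. u x \<noteq> 0}"
    unfolding u_def using finite_support_conv[of f g] supp fin by simp
  have "norm (u x - 1) < e" if x: "x \<in> K" for x
  proof -
    define r where "r = (\<Sum>\<^sub>\<infinity>y. h y powr (1 / q) * h (- x + y) powr (1 / p))"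
    have fs: "finite {y. h (- x + y) \<noteq> 0}" by (rule finite_support_shift[OF fin])
    have s4: "(\<lambda>y. h y powr (1 / q) * h (- x + y) powr (1 / p)) summable_on UNIV"
      by (rule finite_support_summable[OF fin]) simp
    have ur: "u x = complex_of_real r"
      using infsumI[OF has_sum_of_real[OF has_sum_infsum[OF s4], where ?'a = complex]]
      by (simp add: u_def conv_fcheck r_def f_def g_def)
    have "norm (u x) \<le> 1"
      using norm_le_Apnorm[OF p1 Ap_ballD(1)[OF p1 ball], of x] Ap_ballD(2)[OF p1 ball] by simp
    then have "r \<le> 1" by (simp add: ur)
    have s1: "h summable_on UNIV" by (rule finite_support_summable[OF fin])
    have s2: "(\<lambda>y. h (- x + y)) summable_on UNIV" by (rule finite_support_summable[OF fs])
    \<comment> \<open>The function in braces is the indicator of the union of the two supports,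
      outside which the difference vanishes.\<close>
    have fin3: "finite {y. (if h y = 0 \<and> h (- x + y) = 0 then 0 else 1::real) \<noteq> 0}"
      by (rule finite_subset[OF _ finite_UnI[OF fin fs]]) auto
    have s3: "(\<lambda>y. - \<bar>h (- x + y) - h y\<bar>) summable_on UNIV"
      by (rule finite_support_summable[OF fin3]) (auto split: if_splits)
    have "2 - l1_shift h x = (\<Sum>\<^sub>\<infinity>y. h y + h (- x + y) + - \<bar>h (- x + y) - h y\<bar>)"
      unfolding infsum_add[OF summable_on_add[OF s1 s2] s3] infsum_add[OF s1 s2] infsum_uminus
      by (simp add: l1_shift_def infsum_shift h1)
    also have "\<dots> \<le> (\<Sum>\<^sub>\<infinity>y. 2 * (h y powr (1 / q) * h (- x + y) powr (1 / p)))"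
    proof (rule infsum_mono)
      show "(\<lambda>y. h y + h (- x + y) + - \<bar>h (- x + y) - h y\<bar>) summable_on UNIV"
        by (intro summable_on_add s1 s2 s3)
      show "(\<lambda>y. 2 * (h y powr (1 / q) * h (- x + y) powr (1 / p))) summable_on UNIV"
        by (intro summable_on_cmult_right s4)
      fix y
      have "min (h y) (h (- x + y)) \<le> h y powr (1 / q) * h (- x + y) powr (1 / p)"
        using q p1 h0 by (intro min_le_powr_mult) (auto simp: add.commute)
      then show "h y + h (- x + y) + - \<bar>h (- x + y) - h y\<bar> \<le> 2 * (h y powr (1 / q) * h (- x + y) powr (1 / p))"
        by (auto simp: min_def abs_if split: if_splits)
    qed
    also have "\<dots> = 2 * r" unfolding r_def by (rule infsum_cmult_right')
    finally have "1 - r < e" using sh[OF x] e by simp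
    moreover have "norm (u x - 1) = 1 - r"
      unfolding ur using \<open>r \<le> 1\<close> by (metis abs_of_nonneg diff_ge_0_iff_ge norm_minus_commute norm_of_real of_real_1 of_real_diff)
    ultimately show ?thesis by simp
  qed
  with ball usupp show ?thesis by blast
qed

text \<open>Stage k handles the finitely many x with \<open>to_nat x < k\<close> up to 1/(k+1), so
  each x is covered from some stage on and a sequence suffices.\<close>

lemma approximate_identity:
  assumes p1: "1 < p" and am: "amenable TYPE('g::{group_add,countable})"
  obtains E :: "nat \<Rightarrow> 'g::{group_add,countable} \<Rightarrow> complex" where "\<And>k. E k \<in> Ap_ball p" "\<And>k. finite {x. E k x \<noteq> 0}"
    "\<And>x. (\<lambda>k. E k x) \<longlonglongrightarrow> 1"
proof -
  have "\<forall>k. \<exists>u::'g \<Rightarrow> complex. u \<in> Ap_ball p \<and> finite {x. u x \<noteq> 0} \<and>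
      (\<forall>x\<in>{x. to_nat x < k}. norm (u x - 1) < 1 / Suc k)"
    by (intro allI finite_approximate_identity[OF p1 am finite_to_nat_less]) simp
  then obtain E :: "nat \<Rightarrow> 'g \<Rightarrow> complex" where E: "\<And>k. E k \<in> Ap_ball p" "\<And>k. finite {x. E k x \<noteq> 0}"
    "\<And>k x. to_nat x < k \<Longrightarrow> norm (E k x - 1) < 1 / Suc k"
    unfolding choice_iff by blast
  have "(\<lambda>k. E k x) \<longlonglongrightarrow> 1" for x
  proof (rule LIM_zero_cancel, rule Lim_null_comparison[OF _ LIMSEQ_inverse_real_of_nat])
    show "eventually (\<lambda>k. norm (E k x - 1) \<le> inverse (real (Suc k))) sequentially"
      using eventually_gt_at_top[of "to_nat x"]
      by eventually_elim (use E(3) in \<open>force simp: divide_inverse\<close>)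
  qed
  with E(1,2) show thesis using that by blast
qed

section \<open>Characterisations of Arens regularity\<close>

text \<open>Sets of the free ultrafilter are unbounded, so n, then m > n, then k > m can be chosen,
  each limit costing e/3. The outermost limit therefore carries the smallest index.\<close>

lemma iterated_ulim_in_closure:
  fixes a :: "nat \<Rightarrow> nat \<Rightarrow> nat \<Rightarrow> complex"
  assumes b: "\<And>n m k. norm (a n m k) \<le> B"
  shows "ulim (\<lambda>n. ulim (\<lambda>m. ulim (\<lambda>k. a n m k))) \<in> closure {a n m k |n m k. n < m \<and> m < k}"
proof -
  define t where "t n m = ulim (\<lambda>k. a n m k)" for n m
  define c where "c n = ulim (\<lambda>m. t n m)" for n
  have tb: "norm (t n m) \<le> B" for n m unfolding t_def by (rule norm_ulim_le[OF b])
  have cb: "norm (c n) \<le> B" for n unfolding c_def by (rule norm_ulim_le[OF tb])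
  have "\<exists>y\<in>{a n m k |n m k. n < m \<and> m < k}. dist y (ulim c) < e" if e: "e > 0" for e
  proof -
    have e3: "e / 3 > 0" using e by simp
    obtain n where n: "dist (c n) (ulim c) < e / 3"
      using free_ultra_gt_ex[OF tendstoD[OF bounded_tendsto_ulim[of c, OF cb] e3]] by blast
    obtain m where m: "m > n" "dist (t n m) (c n) < e / 3"
      using free_ultra_gt_ex[OF tendstoD[OF bounded_tendsto_ulim[of "t n", OF tb] e3], of n] unfolding c_def by blast
    obtain k where k: "k > m" "dist (a n m k) (t n m) < e / 3"
      using free_ultra_gt_ex[OF tendstoD[OF bounded_tendsto_ulim[of "a n m", OF b] e3], of m] unfolding t_def by blast
    have "dist (a n m k) (ulim c) \<le> dist (a n m k) (t n m) + (dist (t n m) (c n) + dist (c n) (ulim c))"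
      using dist_triangle[of "a n m k" "ulim c" "t n m"] dist_triangle[of "t n m" "ulim c" "c n"] by linarith
    then have "dist (a n m k) (ulim c) < e" using n m k by simp
    with m k show ?thesis by blast
  qed
  then have "ulim c \<in> closure {a n m k |n m k. n < m \<and> m < k}"
    unfolding closure_approachable by blast
  then show ?thesis unfolding c_def[abs_def] t_def[abs_def] .
qed

text \<open>One sequence of indices serves both orders: each new index lies beyond the threshold at
  which the row and the column of every earlier index are within e/2 of their limits. It is
  nondecreasing and may repeat values.\<close>

lemma iterated_limit_subsequence:
  fixes a :: "nat \<Rightarrow> nat \<Rightarrow> complex"
  assumes "\<And>n. (\<lambda>m. a n m) \<longlonglongrightarrow> c n" "c \<longlonglongrightarrow> d" "\<And>m. (\<lambda>n. a n m) \<longlonglongrightarrow> c' m" "c' \<longlonglongrightarrow> d'" "e > 0"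
  obtains r :: "nat \<Rightarrow> nat" where "\<And>i j. i < j \<Longrightarrow> norm (a (r i) (r j) - d) < e"
    "\<And>i j. i < j \<Longrightarrow> norm (a (r j) (r i) - d') < e"
proof -
  have e2: "e / 2 > 0" using assms by simp
  obtain N where N: "\<And>n. n \<ge> N \<Longrightarrow> norm (c n - d) < e / 2 \<and> norm (c' n - d') < e / 2"
    using LIMSEQ_D[OF assms(2) e2] LIMSEQ_D[OF assms(4) e2] by (metis le_cases order_trans)
  have "\<forall>n. \<exists>M. \<forall>x\<ge>M. norm (a n x - c n) < e / 2 \<and> norm (a x n - c' n) < e / 2"
    using LIMSEQ_D[OF assms(1) e2] LIMSEQ_D[OF assms(3) e2] by (metis le_cases order_trans)
  then obtain M where M: "\<And>n x. x \<ge> M n \<Longrightarrow> norm (a n x - c n) < e / 2"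
    "\<And>n x. x \<ge> M n \<Longrightarrow> norm (a x n - c' n) < e / 2" by metis
  define r where "r = rec_nat N (\<lambda>_ x. max x (M x))"
  have r: "r 0 = N" "r (Suc i) = max (r i) (M (r i))" for i by (simp_all add: r_def)
  have mono: "r i \<le> r j" if "i \<le> j" for i j
    using that by (rule lift_Suc_mono_le[of r, rotated]) (simp add: r)
  have rN: "r i \<ge> N" for i using mono[of 0 i] by (simp add: r)
  have rM: "M (r i) \<le> r j" if "i < j" for i j
    using mono[of "Suc i" j] that by (simp add: r)
  show thesis
  proof (rule that)
    fix i j :: nat assume ij: "i < j"
    show "norm (a (r i) (r j) - d) < e"
      using M(1)[OF rM[OF ij]] N[OF rN[of i]] norm_triangle_ineq[of "a (r i) (r j) - c (r i)" "c (r i) - d"] by simp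
    show "norm (a (r j) (r i) - d') < e"
      using M(2)[OF rM[OF ij]] N[OF rN[of i]] norm_triangle_ineq[of "a (r j) (r i) - c' (r i)" "c' (r i) - d'"] by simp
  qed
qed

context
  fixes p :: real
  assumes p1: "1 < p"
begin

lemma double_limit_Yp_imp_arens_regular:
  assumes DL: "\<And>(f :: nat \<Rightarrow> 'g::{group_add,countable} \<Rightarrow> complex) g T c d c' d'.
      (\<And>n. f n \<in> Ap_ball p) \<Longrightarrow> (\<And>m. g m \<in> Ap_ball p) \<Longrightarrow> T \<in> Yp p \<Longrightarrow>
      (\<And>n. (\<lambda>m. T (\<lambda>x. f n x * g m x)) \<longlonglongrightarrow> c n) \<Longrightarrow> c \<longlonglongrightarrow> d \<Longrightarrow>
      (\<And>m. (\<lambda>n. T (\<lambda>x. f n x * g m x)) \<longlonglongrightarrow> c' m) \<Longrightarrow> c' \<longlonglongrightarrow> d' \<Longrightarrow> d = d'"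
  shows "Ap_arens_regular TYPE('g) p"
proof (rule double_limit_imp_arens_regular[OF p1])
  fix f g :: "nat \<Rightarrow> 'g \<Rightarrow> complex" and T c d c' d'
  assume f: "\<And>n. f n \<in> Ap_ball p" and g: "\<And>m. g m \<in> Ap_ball p" and T: "T \<in> Ap_dual p"
    and lims: "\<And>n. (\<lambda>m. T (\<lambda>x. f n x * g m x)) \<longlonglongrightarrow> c n" "c \<longlonglongrightarrow> d"
      "\<And>m. (\<lambda>n. T (\<lambda>x. f n x * g m x)) \<longlonglongrightarrow> c' m" "c' \<longlonglongrightarrow> d'"
  \<comment> \<open>The scalar brings \<open>T\<close> into the unit ball; the added 1 keeps it well
    defined and nonzero when \<open>T\<close> has norm zero.\<close>
  define M where "M = complex_of_real (inverse (dual_norm p T + 1))"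
  have D: "dual_norm p T \<ge> 0" by (rule dual_norm_nonneg[OF p1 T])
  have M: "norm M = inverse (dual_norm p T + 1)"
    unfolding M_def norm_of_real using D by simp
  have "norm (M * T u) \<le> 1" if "u \<in> Ap_ball p" for u
  proof -
    have "norm (M * T u) = norm (T u) / (dual_norm p T + 1)"
      by (simp add: norm_mult M divide_inverse mult.commute)
    also have "\<dots> \<le> 1" using dual_norm_upper[OF p1 T that] D by (simp add: divide_le_eq)
    finally show ?thesis .
  qed
  then have "dual_norm p (\<lambda>u. M * T u) \<le> 1" by (rule dual_norm_leI[OF p1])
  then have "(\<lambda>u. M * T u) \<in> Yp p"
    using Ap_dual_cmult[OF p1 T] by (simp add: Yp_def)
  then have "M * d = M * d'"
    by (rule DL[of f g "\<lambda>u. M * T u" "\<lambda>n. M * c n" "M * d" "\<lambda>m. M * c' m" "M * d'", OF f g])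
       (intro tendsto_mult_left lims)+
  moreover have "M \<noteq> 0" using D by (simp add: M_def del: of_real_add)
  ultimately show "d = d'" by simp
qed

lemma arens_regular_imp_iterated_limits_agree:
  fixes f g :: "nat \<Rightarrow> 'g::{group_add,countable} \<Rightarrow> complex"
  assumes reg: "Ap_arens_regular TYPE('g) p" and f: "\<And>n. f n \<in> Ap_ball p" and g: "\<And>n. g n \<in> Ap_ball p"
    and \<phi>: "\<And>k. \<phi> k \<in> Zp p"
  shows "iterated_limits_agree (\<lambda>n m k. \<phi> k (\<lambda>x. f n x * g m x))"
  unfolding iterated_limits_agree_def
proof (intro allI impI, elim conjE)
  fix b c d c' d'
  assume l: "\<forall>n m. (\<lambda>k. \<phi> k (\<lambda>x. f n x * g m x)) \<longlonglongrightarrow> b n m" "\<forall>n. b n \<longlonglongrightarrow> c n" "c \<longlonglongrightarrow> d"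
    "\<forall>m. (\<lambda>n. b n m) \<longlonglongrightarrow> c' m" "c' \<longlonglongrightarrow> d'"
  have "\<phi> k \<in> Yp p" for k using \<phi> by (auto simp: Zp_def)
  from arens_regular_imp_ulim_swap[OF p1 reg, of f g, OF f g Yp_cluster[OF p1, of \<phi>, OF this]]
  show "d = d'"
    unfolding ulim_LIMSEQ[OF l(1)[rule_format]] ulim_LIMSEQ[OF l(2)[rule_format]] ulim_LIMSEQ[OF l(4)[rule_format]]
      ulim_LIMSEQ[OF l(3)] ulim_LIMSEQ[OF l(5)] .
qed

text \<open>The common value of the two iterated ultrafilter limits is the required point: with n
  outermost it is approached along n < m < k, with m outermost along m < n < k.\<close>

lemma arens_regular_imp_closures_meet:
  fixes f g :: "nat \<Rightarrow> 'g::{group_add,countable} \<Rightarrow> complex"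
  assumes reg: "Ap_arens_regular TYPE('g) p" and f: "\<And>n. f n \<in> Ap_ball p" and g: "\<And>n. g n \<in> Ap_ball p"
    and \<phi>: "\<And>k. \<phi> k \<in> Zp p"
  shows "closure {\<phi> k (\<lambda>x. f n x * g m x) | k n m. k > n \<and> n > m}
              \<inter> closure {\<phi> k (\<lambda>x. f n x * g m x) | k n m. k > m \<and> m > n} \<noteq> {}"
proof -
  have Y: "\<phi> k \<in> Yp p" for k using \<phi> by (auto simp: Zp_def)
  have b: "norm (\<phi> k (\<lambda>x. f n x * g m x)) \<le> 1" for n m k
    using dual_norm_upper[OF p1 _ Ap_ball_mult[OF p1 f g], of "\<phi> k" n m] Y[of k] by (simp add: Yp_def)
  note swap = arens_regular_imp_ulim_swap[OF p1 reg, of f g, OF f g Yp_cluster[OF p1, of \<phi>, OF Y]]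
  have "ulim (\<lambda>n. ulim (\<lambda>m. ulim (\<lambda>k. \<phi> k (\<lambda>x. f n x * g m x))))
      \<in> closure {\<phi> k (\<lambda>x. f n x * g m x) |n m k. n < m \<and> m < k}"
    by (rule iterated_ulim_in_closure[where B = 1]) (rule b)
  also have "{\<phi> k (\<lambda>x. f n x * g m x) |n m k. n < m \<and> m < k} = {\<phi> k (\<lambda>x. f n x * g m x) | k n m. k > m \<and> m > n}"
    by blast
  finally have 1: "ulim (\<lambda>n. ulim (\<lambda>m. ulim (\<lambda>k. \<phi> k (\<lambda>x. f n x * g m x))))
      \<in> closure {\<phi> k (\<lambda>x. f n x * g m x) | k n m. k > m \<and> m > n}" .
  have "ulim (\<lambda>m. ulim (\<lambda>n. ulim (\<lambda>k. \<phi> k (\<lambda>x. f n x * g m x))))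
      \<in> closure {\<phi> k (\<lambda>x. f n x * g m x) |m n k. m < n \<and> n < k}"
    by (rule iterated_ulim_in_closure[where B = 1 and a = "\<lambda>m n k. \<phi> k (\<lambda>x. f n x * g m x)"]) (rule b)
  also have "{\<phi> k (\<lambda>x. f n x * g m x) |m n k. m < n \<and> n < k} = {\<phi> k (\<lambda>x. f n x * g m x) | k n m. k > n \<and> n > m}"
    by blast
  finally show ?thesis using 1 swap by auto
qed

lemma iterated_limits_agree_imp_arens_regular:
  assumes am: "amenable TYPE('g::{group_add,countable})"
    and ii: "\<And>(f :: nat \<Rightarrow> 'g \<Rightarrow> complex) g \<phi>. (\<And>n. f n \<in> Ap_ball p) \<Longrightarrow> (\<And>m. g m \<in> Ap_ball p) \<Longrightarrow>
      (\<And>k. \<phi> k \<in> Zp p) \<Longrightarrow> iterated_limits_agree (\<lambda>n m k. \<phi> k (\<lambda>x. f n x * g m x))"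
  shows "Ap_arens_regular TYPE('g) p"
proof (rule double_limit_Yp_imp_arens_regular)
  fix f g :: "nat \<Rightarrow> 'g \<Rightarrow> complex" and T c d c' d'
  assume f: "\<And>n. f n \<in> Ap_ball p" and g: "\<And>m. g m \<in> Ap_ball p" and T: "T \<in> Yp p"
    and lims: "\<And>n. (\<lambda>m. T (\<lambda>x. f n x * g m x)) \<longlonglongrightarrow> c n" "c \<longlonglongrightarrow> d"
      "\<And>m. (\<lambda>n. T (\<lambda>x. f n x * g m x)) \<longlonglongrightarrow> c' m" "c' \<longlonglongrightarrow> d'"
  obtain E :: "nat \<Rightarrow> 'g \<Rightarrow> complex" where E: "\<And>k. E k \<in> Ap_ball p" "\<And>k. finite {x. E k x \<noteq> 0}"
    "\<And>x. (\<lambda>k. E k x) \<longlonglongrightarrow> 1" by (rule approximate_identity[OF p1 am]) (rule that)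
  have Td: "T \<in> Ap_dual p" using T by (simp add: Yp_def)
  have conv: "(\<lambda>k. dual_act_r p T (E k) (\<lambda>x. f n x * g m x)) \<longlonglongrightarrow> T (\<lambda>x. f n x * g m x)" for n m
    using approximate_identity_tendsto[OF p1 E(1,3) Td, of "\<lambda>x. f n x * g m x"]
      Ap_ballD(1)[OF p1 Ap_ball_mult[OF p1 f g]] by (simp add: dual_act_r_def)
  have "iterated_limits_agree (\<lambda>n m k. dual_act_r p T (E k) (\<lambda>x. f n x * g m x))"
    by (rule ii[OF f g dual_act_r_in_Zp[OF p1 E(1,2) T]])
  from this[unfolded iterated_limits_agree_def, rule_format,
      of "\<lambda>n m. T (\<lambda>x. f n x * g m x)" c d c' d']
  show "d = d'" using conv lims by blast
qed

text \<open>If the iterated limits d and d' differ, thinning the sequences puts T(f_n g_m) near d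
  for all n < m and near d' for all m < n. Replacing T by suitable elements of \<open>Zp\<close>
  keeps this true for all k > n, m, so the two closures are separated.\<close>

lemma closures_meet_imp_arens_regular:
  assumes am: "amenable TYPE('g::{group_add,countable})"
    and iii: "\<And>(f :: nat \<Rightarrow> 'g \<Rightarrow> complex) g \<phi>. (\<And>n. f n \<in> Ap_ball p) \<Longrightarrow> (\<And>m. g m \<in> Ap_ball p) \<Longrightarrow>
      (\<And>k. \<phi> k \<in> Zp p) \<Longrightarrow> closure {\<phi> k (\<lambda>x. f n x * g m x) | k n m. k > n \<and> n > m}
              \<inter> closure {\<phi> k (\<lambda>x. f n x * g m x) | k n m. k > m \<and> m > n} \<noteq> {}"
  shows "Ap_arens_regular TYPE('g) p"
proof (rule double_limit_Yp_imp_arens_regular, rule ccontr)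
  fix f g :: "nat \<Rightarrow> 'g \<Rightarrow> complex" and T c d c' d'
  assume f: "\<And>n. f n \<in> Ap_ball p" and g: "\<And>m. g m \<in> Ap_ball p" and T: "T \<in> Yp p"
    and lims: "\<And>n. (\<lambda>m. T (\<lambda>x. f n x * g m x)) \<longlonglongrightarrow> c n" "c \<longlonglongrightarrow> d"
      "\<And>m. (\<lambda>n. T (\<lambda>x. f n x * g m x)) \<longlonglongrightarrow> c' m" "c' \<longlonglongrightarrow> d'"
    and "d \<noteq> d'"
  \<comment> \<open>Thinning and the replacement of \<open>T\<close> each cost e, so the closures
    lie in balls of radius 2e about d and d'; these are disjoint because 5e > 4e.\<close>
  define e where "e = dist d d' / 5"
  have e: "e > 0" using \<open>d \<noteq> d'\<close> by (simp add: e_def)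
  obtain E :: "nat \<Rightarrow> 'g \<Rightarrow> complex" where E: "\<And>k. E k \<in> Ap_ball p" "\<And>k. finite {x. E k x \<noteq> 0}"
    "\<And>x. (\<lambda>k. E k x) \<longlonglongrightarrow> 1" by (rule approximate_identity[OF p1 am]) (rule that)
  obtain r :: "nat \<Rightarrow> nat" where r: "\<And>i j. i < j \<Longrightarrow> norm (T (\<lambda>x. f (r i) x * g (r j) x) - d) < e"
    "\<And>i j. i < j \<Longrightarrow> norm (T (\<lambda>x. f (r j) x * g (r i) x) - d') < e"
    by (rule iterated_limit_subsequence[OF lims e]) (rule that)
  have Td: "T \<in> Ap_dual p" using T by (simp add: Yp_def)
  have conv: "(\<lambda>k. dual_act_r p T (E k) (\<lambda>x. f n x * g m x)) \<longlonglongrightarrow> T (\<lambda>x. f n x * g m x)" for n m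
    using approximate_identity_tendsto[OF p1 E(1,3) Td, of "\<lambda>x. f n x * g m x"]
      Ap_ballD(1)[OF p1 Ap_ball_mult[OF p1 f g]] by (simp add: dual_act_r_def)
  \<comment> \<open>Convergence is only pointwise, but \<phi>_k has to be good just for the finitely
    many pairs n, m < k; the sets in (iii) contain only such pairs.\<close>
  have "\<exists>s. \<forall>n\<in>{..<k}. \<forall>m\<in>{..<k}. dist (dual_act_r p T (E s) (\<lambda>x. f (r n) x * g (r m) x)) (T (\<lambda>x. f (r n) x * g (r m) x)) < e" for k
  proof -
    have "eventually (\<lambda>s. \<forall>n\<in>{..<k}. \<forall>m\<in>{..<k}. dist (dual_act_r p T (E s) (\<lambda>x. f (r n) x * g (r m) x)) (T (\<lambda>x. f (r n) x * g (r m) x)) < e) sequentially"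
      by (intro eventually_ball_finite ballI finite_lessThan tendstoD[OF conv e])
    then show ?thesis using eventually_happens'[OF sequentially_bot] by blast
  qed
  then obtain s where s: "\<And>k n m. n < k \<Longrightarrow> m < k \<Longrightarrow>
      dist (dual_act_r p T (E (s k)) (\<lambda>x. f (r n) x * g (r m) x)) (T (\<lambda>x. f (r n) x * g (r m) x)) < e"
    by (metis lessThan_iff)
  define \<phi> where "\<phi> k = dual_act_r p T (E (s k))" for k
  have \<phi>: "\<phi> k \<in> Zp p" for k unfolding \<phi>_def by (rule dual_act_r_in_Zp[OF p1 E(1,2) T])
  have near: "\<phi> k (\<lambda>x. f (r n) x * g (r m) x) \<in> cball l (2 * e)"
    if "n < k" "m < k" "norm (T (\<lambda>x. f (r n) x * g (r m) x) - l) < e" for k n m l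
    using s[OF that(1,2)] that(3) dist_triangle[of l "\<phi> k (\<lambda>x. f (r n) x * g (r m) x)" "T (\<lambda>x. f (r n) x * g (r m) x)"]
    by (simp add: \<phi>_def dist_norm norm_minus_commute)
  have "closure {\<phi> k (\<lambda>x. f (r n) x * g (r m) x) | k n m. k > n \<and> n > m} \<subseteq> cball d' (2 * e)"
    by (rule closure_minimal) (auto simp del: mem_cball intro!: near r)
  moreover have "closure {\<phi> k (\<lambda>x. f (r n) x * g (r m) x) | k n m. k > m \<and> m > n} \<subseteq> cball d (2 * e)"
    by (rule closure_minimal) (auto simp del: mem_cball intro!: near r)
  moreover have "cball d' (2 * e) \<inter> cball d (2 * e) = {}"
  proof -
    have False if "dist d' y \<le> 2 * e" "dist d y \<le> 2 * e" for y
    proof -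
      have "dist d d' = 5 * e" by (simp add: e_def)
      then show False using dist_triangle[of d d' y] that e unfolding dist_commute[of y d'] by linarith
    qed
    then show ?thesis by auto
  qed
  ultimately show False
    using iii[of "\<lambda>n. f (r n)" "\<lambda>n. g (r n)" \<phi>, OF f g \<phi>] by blast
qed

end

theorem theorem3p5:
  fixes p :: real
  assumes "1 < p" and "amenable TYPE('g::{group_add,countable})"
  shows "(Ap_arens_regular TYPE('g) p \<longleftrightarrow>
           (\<forall>(f :: nat \<Rightarrow> 'g \<Rightarrow> complex) (g :: nat \<Rightarrow> 'g \<Rightarrow> complex) \<phi>.
              (\<forall>n. f n \<in> Ap_ball p) \<and> (\<forall>m. g m \<in> Ap_ball p) \<and> (\<forall>k. \<phi> k \<in> Zp p) \<longrightarrow>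
              iterated_limits_agree (\<lambda>n m k. \<phi> k (\<lambda>x. f n x * g m x))))
       \<and> (Ap_arens_regular TYPE('g) p \<longleftrightarrow>
           (\<forall>(f :: nat \<Rightarrow> 'g \<Rightarrow> complex) (g :: nat \<Rightarrow> 'g \<Rightarrow> complex) \<phi>.
              (\<forall>n. f n \<in> Ap_ball p) \<and> (\<forall>m. g m \<in> Ap_ball p) \<and> (\<forall>k. \<phi> k \<in> Zp p) \<longrightarrow>
              closure {\<phi> k (\<lambda>x. f n x * g m x) | k n m. k > n \<and> n > m}
              \<inter> closure {\<phi> k (\<lambda>x. f n x * g m x) | k n m. k > m \<and> m > n} \<noteq> {}))"
proof (intro conjI iffI allI impI; (elim conjE)?)
  show "Ap_arens_regular TYPE('g) p"
    if "\<forall>(f :: nat \<Rightarrow> 'g \<Rightarrow> complex) (g :: nat \<Rightarrow> 'g \<Rightarrow> complex) \<phi>.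
              (\<forall>n. f n \<in> Ap_ball p) \<and> (\<forall>m. g m \<in> Ap_ball p) \<and> (\<forall>k. \<phi> k \<in> Zp p) \<longrightarrow>
              iterated_limits_agree (\<lambda>n m k. \<phi> k (\<lambda>x. f n x * g m x))"
    by (rule iterated_limits_agree_imp_arens_regular[OF assms]) (use that in blast)
  show "Ap_arens_regular TYPE('g) p"
    if "\<forall>(f :: nat \<Rightarrow> 'g \<Rightarrow> complex) (g :: nat \<Rightarrow> 'g \<Rightarrow> complex) \<phi>.
              (\<forall>n. f n \<in> Ap_ball p) \<and> (\<forall>m. g m \<in> Ap_ball p) \<and> (\<forall>k. \<phi> k \<in> Zp p) \<longrightarrow>
              closure {\<phi> k (\<lambda>x. f n x * g m x) | k n m. k > n \<and> n > m}
              \<inter> closure {\<phi> k (\<lambda>x. f n x * g m x) | k n m. k > m \<and> m > n} \<noteq> {}"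
    by (rule closures_meet_imp_arens_regular[OF assms]) (use that in blast)
qed (simp_all add: arens_regular_imp_iterated_limits_agree[OF assms(1)]
      arens_regular_imp_closures_meet[OF assms(1)])

end
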